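(* Let $a:\mathbb{R}\to\mathbb{R}_+$ be differentiable and strictly convex, and consider the scalar conservation law with random initial data $$\partial_t u+\partial_x\big(a(u)\big)=0,\qquad u(0,x;\omega)=u_{(0,x)}(\omega).$$ Let $\phi_{t,x}=u(t,x;\cdot)_\sharp\mu$ be the pointwise statistics. Assume that the probability density function $f(t,x,U)$ of $\phi_{t,x}$ exists for all $t\ge 0$ and $x\in\mathbb{R}$, and that the probability of shocks forming on $[0,t]$ is zero. Then $f(t,x,U)$ satisfies $$\partial_t f+\frac{\partial}{\partial U}\left(a'(U)\int_{-\infty}^{U}\partial_x f(t,x,v)\,\mathrm{d}v\right)=0.$$
   Context: $\Omega\subseteq\mathbb{R}^d$ is equipped with a Borel probability measure $\mu$. For every $x\in\mathbb{R}$ the initial datum $u_{(0,x)}:\Omega\to\mathbb{R}$ is measurable. For fixed $(t,x)$, the pointwise statistics $\phi_{t,x}$ is the pushforward probability measure on $\mathbb{R}$ given by $\phi_{t,x}(A)=\mu(\{\omega\in\Omega:u(t,x;\omega)\in A\})$ for all Borel $A\subseteq\mathbb{R}$. That the probability of shocks forming on $[0,t]$ is zero means that for $\mu$-almost every $\omega$ the solution $u(\cdot,\cdot;\omega)$ is a strong solution on $[0,t]$ (characteristics do not cross). *)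

theory Defs
  imports "HOL-Probability.Probability"
begin

definition strictly_convex :: "(real \<Rightarrow> real) \<Rightarrow> bool" where
  "strictly_convex a \<longleftrightarrow>
     (\<forall>x y s. x \<noteq> y \<longrightarrow> 0 < s \<longrightarrow> s < 1 \<longrightarrow>
        a ((1 - s) * x + s * y) < (1 - s) * a x + s * a y)"

text \<open>
  A strong solution satisfies the conservation law pointwise. The time derivatives are taken
  at interior times only; at the two end points of the time interval the solution is continuous.
\<close>

definition strong_solution ::
  "(real \<Rightarrow> real) \<Rightarrow> real \<Rightarrow> (real \<Rightarrow> real) \<Rightarrow> (real \<Rightarrow> real \<Rightarrow> real) \<Rightarrow> bool" where
  "strong_solution a T v0 v \<longleftrightarrow>
     continuous_on ({0..T} \<times> UNIV) (\<lambda>(t, x). v t x) \<and>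
     (\<forall>x. v 0 x = v0 x) \<and>
     (\<forall>t\<in>{0<..<T}. \<forall>x.
        (\<lambda>(s, y). v s y) differentiable (at (t, x)) \<and>
        deriv (\<lambda>s. v s x) t + deriv (\<lambda>y. a (v t y)) x = 0)"

definition no_shocks_almost_surely ::
  "(real \<Rightarrow> real) \<Rightarrow> real \<Rightarrow> 'w measure \<Rightarrow> (real \<Rightarrow> 'w \<Rightarrow> real) \<Rightarrow> (real \<Rightarrow> real \<Rightarrow> 'w \<Rightarrow> real) \<Rightarrow> bool" where
  "no_shocks_almost_surely a T M u0 u \<longleftrightarrow>
     (AE w in M. strong_solution a T (\<lambda>x. u0 x w) (\<lambda>t x. u t x w))"

definition pointwise_statistics ::
  "'w measure \<Rightarrow> (real \<Rightarrow> real \<Rightarrow> 'w \<Rightarrow> real) \<Rightarrow> real \<Rightarrow> real \<Rightarrow> real measure" where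
  "pointwise_statistics M u t x = distr M borel (u t x)"

definition is_pdf :: "real measure \<Rightarrow> (real \<Rightarrow> real) \<Rightarrow> bool" where
  "is_pdf P p \<longleftrightarrow>
     p \<in> borel_measurable borel \<and> (\<forall>U. 0 \<le> p U) \<and> P = density lborel (\<lambda>U. ennreal (p U))"

text \<open>
  Functions all of whose iterated directional derivatives up to order \<open>k\<close> exist and are
  continuous, and the usual test functions on the open set of all \<open>(t, x, U)\<close> with
  \<open>0 < t < T\<close>.
\<close>

primrec Ck :: "nat \<Rightarrow> ('a::euclidean_space \<Rightarrow> real) \<Rightarrow> bool" where
  "Ck 0 g \<longleftrightarrow> continuous_on UNIV g"
| "Ck (Suc k) g \<longleftrightarrow>
     (\<forall>p. g differentiable (at p)) \<and> (\<forall>h. Ck k (\<lambda>p. frechet_derivative g (at p) h))"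

definition test_function :: "real \<Rightarrow> (real \<times> real \<times> real \<Rightarrow> real) \<Rightarrow> bool" where
  "test_function T \<psi> \<longleftrightarrow>
     (\<forall>k. Ck k \<psi>) \<and> compact (closure {p. \<psi> p \<noteq> 0}) \<and>
     closure {p. \<psi> p \<noteq> 0} \<subseteq> {0<..<T} \<times> UNIV \<times> UNIV"

text \<open>
  The equation
    \<open>\<partial>\<^sub>t f + \<partial>\<^sub>U (a'(U) \<integral>\<^bsub>-\<infinity>\<^esub>\<^bsup>U\<^esup> \<partial>\<^sub>x f dv) = 0\<close>
  in the sense of distributions. The integral of \<open>\<partial>\<^sub>x f\<close> over \<open>v \<le> U\<close> is read as the
  distributional \<open>x\<close>-derivative of \<open>F(t, x, U) = \<integral>\<^bsub>-\<infinity>\<^esub>\<^bsup>U\<^esup> f(t, x, v) dv\<close>, so that all derivatives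
  except \<open>a'\<close> fall on the test function. A family of densities is unique only up to
  null sets in \<open>U\<close> for each \<open>(t, x)\<close> and need not be jointly measurable; this is why the
  integrals are iterated with \<open>U\<close> innermost.
\<close>

definition solves_pdf_equation_distributionally ::
  "(real \<Rightarrow> real) \<Rightarrow> real \<Rightarrow> (real \<Rightarrow> real \<Rightarrow> real \<Rightarrow> real) \<Rightarrow> bool" where
  "solves_pdf_equation_distributionally a T f \<longleftrightarrow>
     (\<forall>\<psi>. test_function T \<psi> \<longrightarrow>
        - (LBINT t. LBINT x. LBINT U. f t x U * deriv (\<lambda>s. \<psi> (s, x, U)) t)
        + (LBINT t. LBINT x. LBINT U.
             deriv a U * (LBINT v:{..U}. f t x v) * deriv (\<lambda>y. deriv (\<lambda>V. \<psi> (t, y, V)) U) x)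
        = 0)"

text \<open>
  Regularity under which the terms of the equation are defined pointwise: \<open>\<partial>\<^sub>t f\<close> and
  \<open>\<partial>\<^sub>x f\<close> exist, \<open>\<partial>\<^sub>t f\<close> is continuous in \<open>U\<close>, and both are dominated, locally uniformly
  in \<open>(t, x)\<close>, by an integrable function of \<open>U\<close>.
\<close>

definition regular_density :: "real \<Rightarrow> (real \<Rightarrow> real \<Rightarrow> real \<Rightarrow> real) \<Rightarrow> bool" where
  "regular_density T f \<longleftrightarrow>
     (\<forall>t\<in>{0<..<T}. \<forall>x.
        (\<forall>U. (\<lambda>s. f s x U) differentiable (at t) \<and> (\<lambda>y. f t y U) differentiable (at x)) \<and>
        continuous_on UNIV (\<lambda>U. deriv (\<lambda>s. f s x U) t)) \<and>
     (\<forall>t0\<in>{0<..<T}. \<forall>x0. \<exists>\<delta>>0. \<exists>g. integrable lborel g \<and>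
        (\<forall>t\<in>{0<..<T}. \<forall>x v. \<bar>t - t0\<bar> < \<delta> \<longrightarrow> \<bar>x - x0\<bar> < \<delta> \<longrightarrow>
           \<bar>deriv (\<lambda>s. f s x v) t\<bar> \<le> g v \<and> \<bar>deriv (\<lambda>y. f t y v) x\<bar> \<le> g v))"

definition solves_pdf_equation_pointwise ::
  "(real \<Rightarrow> real) \<Rightarrow> real \<Rightarrow> (real \<Rightarrow> real \<Rightarrow> real \<Rightarrow> real) \<Rightarrow> bool" where
  "solves_pdf_equation_pointwise a T f \<longleftrightarrow>
     (\<forall>t\<in>{0<..<T}. \<forall>x U.
        (\<lambda>s. f s x U) differentiable (at t) \<and>
        set_integrable lborel {..U} (\<lambda>v. deriv (\<lambda>y. f t y v) x) \<and>
        (\<lambda>V. deriv a V * (LBINT v:{..V}. deriv (\<lambda>y. f t y v) x)) differentiable (at U) \<and>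
        deriv (\<lambda>s. f s x U) t
          + deriv (\<lambda>V. deriv a V * (LBINT v:{..V}. deriv (\<lambda>y. f t y v) x)) U = 0)"

end

theory Submission
  imports Defs
begin

text \<open>
  Fix a level \<open>U\<close> and move with its characteristic speed \<open>c = a'(U)\<close>: \<open>v(t, y) = u(t, y + c t)\<close>. A
  smooth step \<open>\<eta>\<close> at \<open>U\<close> of width \<open>\<epsilon>\<close> turns the conservation law into
  \<open>\<partial>\<^sub>t \<eta>(v) + \<partial>\<^sub>y q(v) = 0\<close> with \<open>q' = \<eta>' (a' - c)\<close>, so that \<open>\<bar>q\<bar> \<le> sup \<bar>a' - c\<bar>\<close> over an interval of
  length \<open>\<epsilon>\<close>, which tends to 0. Hence no mass of \<open>{v > U}\<close> crosses any point \<open>y\<close>, and after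
  taking expectations the distribution function satisfies \<open>F(t, y + a'(U) t, U) = F(s, y + a'(U) s, U)\<close>
  for almost every \<open>y\<close>. This is \<open>\<partial>\<^sub>t F + a'(U) \<partial>\<^sub>x F = 0\<close> in integrated form; its \<open>U\<close>-derivative is
  the claim. Since the solution is only differentiable, the divergence theorem is
  obtained by a Goursat argument.
\<close>

section \<open>The divergence theorem for differentiable fields\<close>

text \<open>The level \<open>U\<close> is fixed first because the line \<open>y + a'(U) t\<close> is
  then the same for every outcome, whereas the characteristic through a given point is random.
  Expectation and integration over \<open>y\<close> therefore commute, and no characteristic of the
  solution has to be constructed. What is conserved along the lines is the mass over each interval
  of \<open>y\<close>, and this determines functions of \<open>y\<close> only up to null sets. That
  suffices for the weak equation; for the pointwise one, continuity of \<open>F\<close> in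
  \<open>x\<close> removes the exceptional set.

  A second obstacle is measurability: the densities \<open>f\<close> need not be jointly measurable,
  so every interchange of integrals is made with \<open>F\<close>. Joint measurability of
  \<open>F\<close> rests on continuity of the solution in \<open>(t, x)\<close> for every outcome,
  which is arranged by changing the solution on a null set and freezing it in time outside
  \<open>[0, T]\<close>.\<close>

definition boundary_flux ::
  "(real \<times> real \<Rightarrow> real) \<Rightarrow> (real \<times> real \<Rightarrow> real) \<Rightarrow> real \<Rightarrow> real \<Rightarrow> real \<Rightarrow> real \<Rightarrow> real" where
  "boundary_flux Q P t A x B =
     integral {x..x + B} (\<lambda>y. Q (t + A, y) - Q (t, y)) +
     integral {t..t + A} (\<lambda>s. P (s, x + B) - P (s, x))"

lemma continuous_on_slice_fst:
  fixes Q :: "real \<times> real \<Rightarrow> real"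
  assumes "continuous_on (I \<times> J) Q" "y \<in> J" "S \<subseteq> I"
  shows "continuous_on S (\<lambda>s. Q (s, y))"
  using assms by (intro continuous_on_compose2[OF assms(1)]) (auto intro!: continuous_intros)

lemma continuous_on_slice_snd:
  fixes Q :: "real \<times> real \<Rightarrow> real"
  assumes "continuous_on (I \<times> J) Q" "s \<in> I" "S \<subseteq> J"
  shows "continuous_on S (\<lambda>y. Q (s, y))"
  using assms by (intro continuous_on_compose2[OF assms(1)]) (auto intro!: continuous_intros)

text \<open>\<open>boundary_flux\<close> is the outward flux of the field \<open>(Q, P)\<close>
  through the boundary of a rectangle with sides \<open>A\<close> in time and \<open>B\<close> in
  space. Each inner edge of the subdivision belongs to two quarters with opposite outward normals,
  so the inner contributions cancel.\<close>

lemma boundary_flux_quarter: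
  fixes Q P :: "real \<times> real \<Rightarrow> real"
  assumes Q: "continuous_on ({t..t + A} \<times> {x..x + B}) Q"
    and P: "continuous_on ({t..t + A} \<times> {x..x + B}) P"
    and "0 < A" "0 < B"
  shows "boundary_flux Q P t A x B =
     boundary_flux Q P t (A/2) x (B/2) + boundary_flux Q P (t + A/2) (A/2) x (B/2) +
     boundary_flux Q P t (A/2) (x + B/2) (B/2) + boundary_flux Q P (t + A/2) (A/2) (x + B/2) (B/2)"
proof -
  have iQ: "(\<lambda>y. Q (s, y)) integrable_on {p..q}"
    if "s \<in> {t..t + A}" "x \<le> p" "q \<le> x + B" for s p q
    using that by (intro integrable_continuous_real continuous_on_slice_snd[OF Q]) auto
  have iP: "(\<lambda>s. P (s, y)) integrable_on {p..q}"
    if "y \<in> {x..x + B}" "t \<le> p" "q \<le> t + A" for y p q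
    using that by (intro integrable_continuous_real continuous_on_slice_fst[OF P]) auto
  have cQ: "integral {x..x+B} (\<lambda>y. Q (s, y)) =
      integral {x..x+B/2} (\<lambda>y. Q (s, y)) + integral {x+B/2..x+B} (\<lambda>y. Q (s, y))"
    if "s \<in> {t..t + A}" for s
    using assms(4) that by (intro Henstock_Kurzweil_Integration.integral_combine[symmetric] iQ) auto
  have cP: "integral {t..t+A} (\<lambda>s. P (s, y)) =
      integral {t..t+A/2} (\<lambda>s. P (s, y)) + integral {t+A/2..t+A} (\<lambda>s. P (s, y))"
    if "y \<in> {x..x + B}" for y
    using assms(3) that by (intro Henstock_Kurzweil_Integration.integral_combine[symmetric] iP) auto
  have [simp]: "x + B/2 + B/2 = x + B" "t + A/2 + A/2 = t + A" by simp_all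
  have dQ: "integral {p..q} (\<lambda>y. Q (s, y) - Q (s', y)) =
      integral {p..q} (\<lambda>y. Q (s, y)) - integral {p..q} (\<lambda>y. Q (s', y))"
    if "s \<in> {t..t + A}" "s' \<in> {t..t + A}" "x \<le> p" "q \<le> x + B" for s s' p q
    using that by (intro Henstock_Kurzweil_Integration.integral_diff iQ) auto
  have dP: "integral {p..q} (\<lambda>s. P (s, y) - P (s, y')) =
      integral {p..q} (\<lambda>s. P (s, y)) - integral {p..q} (\<lambda>s. P (s, y'))"
    if "y \<in> {x..x + B}" "y' \<in> {x..x + B}" "t \<le> p" "q \<le> t + A" for y y' p q
    using that by (intro Henstock_Kurzweil_Integration.integral_diff iP) auto
  show ?thesis
    using assms(3,4) unfolding boundary_flux_def
    by (simp add: dQ dP cQ cP)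
qed

text \<open>The affine part of the field at \<open>p\<close> has divergence
  \<open>Q' (1, 0) + P' (0, 1) = 0\<close> and contributes nothing. What remains at any point is at
  most \<open>e * (A + B)\<close>, since \<open>A + B\<close> bounds the distance to
  \<open>p\<close>. Opposite edges give \<open>2 * e * (A + B)\<close>, and integration over lengths
  \<open>B\<close> and \<open>A\<close> gives the second factor \<open>A + B\<close>.\<close>

lemma boundary_flux_small:
  fixes Q P :: "real \<times> real \<Rightarrow> real"
  assumes Q: "continuous_on ({t..t + A} \<times> {x..x + B}) Q"
    and P: "continuous_on ({t..t + A} \<times> {x..x + B}) P"
    and AB: "0 < A" "0 < B"
    and p: "p \<in> {t..t + A} \<times> {x..x + B}"
    and lin: "linear Q'" "linear P'" "Q' (1, 0) + P' (0, 1) = 0"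
    and Qe: "\<And>z. z \<in> {t..t + A} \<times> {x..x + B} \<Longrightarrow> \<bar>Q z - Q p - Q' (z - p)\<bar> \<le> e * norm (z - p)"
    and Pe: "\<And>z. z \<in> {t..t + A} \<times> {x..x + B} \<Longrightarrow> \<bar>P z - P p - P' (z - p)\<bar> \<le> e * norm (z - p)"
    and e: "0 \<le> e"
  shows "\<bar>boundary_flux Q P t A x B\<bar> \<le> 2 * e * (A + B)\<^sup>2"
proof -
  have nrm: "norm (z - p) \<le> A + B" if "z \<in> {t..t + A} \<times> {x..x + B}" for z
  proof -
    have "norm (z - p) \<le> norm (fst z - fst p) + norm (snd z - snd p)"
      by (simp add: norm_prod_def sqrt_sum_squares_le_sum_abs)
    also have "\<dots> \<le> A + B"
      using that p by (intro add_mono) (auto simp: mem_Times_iff)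
    finally show ?thesis .
  qed
  have Qb: "\<bar>(Q (t + A, y) - Q (t, y)) - A * Q' (1, 0)\<bar> \<le> 2 * e * (A + B)" if "y \<in> {x..x+B}" for y
  proof -
    have in1: "(t + A, y) \<in> {t..t + A} \<times> {x..x + B}" "(t, y) \<in> {t..t + A} \<times> {x..x + B}"
      using that AB by auto
    have "Q' ((t + A, y) - p) - Q' ((t, y) - p) = Q' (A *\<^sub>R (1, 0))"
      by (subst linear_diff[OF lin(1), symmetric]) simp
    also have "\<dots> = A * Q' (1, 0)" using linear_scale[OF lin(1), of A "(1, 0)"] by simp
    finally have "Q' ((t + A, y) - p) - Q' ((t, y) - p) = A * Q' (1, 0)" .
    moreover have "e * norm ((t + A, y) - p) \<le> e * (A + B)" "e * norm ((t, y) - p) \<le> e * (A + B)"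
      using nrm in1 e by (auto intro!: mult_left_mono)
    ultimately show ?thesis using Qe[OF in1(1)] Qe[OF in1(2)] by linarith
  qed
  have Pb: "\<bar>(P (s, x + B) - P (s, x)) - B * P' (0, 1)\<bar> \<le> 2 * e * (A + B)" if "s \<in> {t..t+A}" for s
  proof -
    have in1: "(s, x + B) \<in> {t..t + A} \<times> {x..x + B}" "(s, x) \<in> {t..t + A} \<times> {x..x + B}"
      using that AB by auto
    have "P' ((s, x + B) - p) - P' ((s, x) - p) = P' (B *\<^sub>R (0, 1))"
      by (subst linear_diff[OF lin(2), symmetric]) simp
    also have "\<dots> = B * P' (0, 1)" using linear_scale[OF lin(2), of B "(0, 1)"] by simp
    finally have "P' ((s, x + B) - p) - P' ((s, x) - p) = B * P' (0, 1)" .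
    moreover have "e * norm ((s, x + B) - p) \<le> e * (A + B)" "e * norm ((s, x) - p) \<le> e * (A + B)"
      using nrm in1 e by (auto intro!: mult_left_mono)
    ultimately show ?thesis using Pe[OF in1(1)] Pe[OF in1(2)] by linarith
  qed
  have cQ: "continuous_on {x..x+B} (\<lambda>y. Q (t + A, y) - Q (t, y))"
    using AB by (intro continuous_on_diff continuous_on_slice_snd[OF Q]) auto
  have cP: "continuous_on {t..t+A} (\<lambda>s. P (s, x + B) - P (s, x))"
    using AB by (intro continuous_on_diff continuous_on_slice_fst[OF P]) auto
  have "integral {x..x+B} (\<lambda>y. (Q (t + A, y) - Q (t, y)) - A * Q' (1, 0)) =
      integral {x..x+B} (\<lambda>y. Q (t + A, y) - Q (t, y)) - A * B * Q' (1, 0)"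
    using AB by (subst Henstock_Kurzweil_Integration.integral_diff)
      (auto intro!: integrable_continuous_real cQ)
  moreover have "norm (integral {x..x+B} (\<lambda>y. (Q (t + A, y) - Q (t, y)) - A * Q' (1, 0)))
      \<le> 2 * e * (A + B) * (x + B - x)"
    using AB Qb by (intro integral_bound continuous_intros cQ) auto
  moreover have "integral {t..t+A} (\<lambda>s. (P (s, x + B) - P (s, x)) - B * P' (0, 1)) =
      integral {t..t+A} (\<lambda>s. P (s, x + B) - P (s, x)) - A * B * P' (0, 1)"
    using AB by (subst Henstock_Kurzweil_Integration.integral_diff)
      (auto intro!: integrable_continuous_real cP)
  moreover have "norm (integral {t..t+A} (\<lambda>s. (P (s, x + B) - P (s, x)) - B * P' (0, 1)))
      \<le> 2 * e * (A + B) * (t + A - t)"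
    using AB Pb by (intro integral_bound continuous_intros cP) auto
  ultimately have
    "\<bar>boundary_flux Q P t A x B - A * B * (Q' (1, 0) + P' (0, 1))\<bar>
      \<le> 2 * e * (A + B) * B + 2 * e * (A + B) * A"
    unfolding boundary_flux_def by (simp add: algebra_simps abs_le_iff)
  then show ?thesis unfolding lin(3) by (simp add: algebra_simps power2_eq_square)
qed

text \<open>Goursat's bisection argument: the partial derivatives of the field need not be continuous.\<close>

lemma boundary_flux_eq_0:
  fixes Q P :: "real \<times> real \<Rightarrow> real"
  assumes diff: "\<And>z. z \<in> {t..t + A} \<times> {x..x + B} \<Longrightarrow>
      \<exists>Q' P'. (Q has_derivative Q') (at z) \<and> (P has_derivative P') (at z) \<and> Q' (1, 0) + P' (0, 1) = 0"
    and AB: "0 < A" "0 < B"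
  shows "boundary_flux Q P t A x B = 0"
proof (rule ccontr)
  define R where "R = {t..t + A} \<times> {x..x + B}"
  assume ne: "boundary_flux Q P t A x B \<noteq> 0"
  define \<Phi> where "\<Phi> n q = boundary_flux Q P (fst q) (A / 2^n) (snd q) (B / 2^n)" for n :: nat and q
  define sq where "sq n q = {fst q..fst q + A/2^n} \<times> {snd q..snd q + B/2^n}"
    for n :: nat and q :: "real \<times> real"
  have cont: "continuous_on R Q" "continuous_on R P"
    using diff unfolding R_def
    by (meson continuous_at_imp_continuous_on has_derivative_continuous)+
  \<comment> \<open>The invariant of the bisection: the rectangle of generation \<open>n\<close>
    stays in \<open>R\<close> and keeps at least the fraction \<open>1 / 4^n\<close> of the total
    flux. The bound of \<open>boundary_flux_small\<close> decays at the same rate, but with an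
    arbitrarily small factor.\<close>
  define G where "G n q \<longleftrightarrow> sq n q \<subseteq> R \<and> \<bar>boundary_flux Q P t A x B\<bar> / 4^n \<le> \<bar>\<Phi> n q\<bar>"
    for n q
  have ex: "\<exists>f. \<forall>n. G n (f n) \<and> fst (f n) \<le> fst (f (Suc n)) \<and> snd (f n) \<le> snd (f (Suc n))
      \<and> fst (f (Suc n)) + A/2^Suc n \<le> fst (f n) + A/2^n
      \<and> snd (f (Suc n)) + B/2^Suc n \<le> snd (f n) + B/2^n"
  proof -
    have G0: "G 0 (t, x)" by (simp add: G_def sq_def R_def \<Phi>_def)
    have step: "\<exists>q'. G (Suc n) q' \<and> (fst q \<le> fst q' \<and> snd q \<le> snd q'
      \<and> fst q' + A/2^Suc n \<le> fst q + A/2^n \<and> snd q' + B/2^Suc n \<le> snd q + B/2^n)"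
      if "G n q" for n q
    proof -
      define A' where "A' = A/2^Suc n"
      define B' where "B' = B/2^Suc n"
      have AB': "A/2^n = A' + A'" "B/2^n = B' + B'" "A' > 0" "B' > 0"
        using AB by (auto simp: A'_def B'_def)
      have sub: "sq n q \<subseteq> R" using that by (simp add: G_def)
      have quarter: "\<Phi> n q = \<Phi> (Suc n) q + \<Phi> (Suc n) (fst q + A', snd q)
          + \<Phi> (Suc n) (fst q, snd q + B') + \<Phi> (Suc n) (fst q + A', snd q + B')"
        using boundary_flux_quarter[of "fst q" "A/2^n" "snd q" "B/2^n" Q P]
          continuous_on_subset[OF cont(1) sub] continuous_on_subset[OF cont(2) sub] AB
        unfolding \<Phi>_def sq_def A'_def B'_def by (simp add: mult.commute)
      let ?Z = "{q, (fst q + A', snd q), (fst q, snd q + B'), (fst q + A', snd q + B')}"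
      \<comment> \<open>Four numbers with sum \<open>\<Phi> n q\<close> cannot all be smaller than a
        quarter of it in absolute value.\<close>
      have "\<exists>q'\<in>?Z. \<bar>\<Phi> n q\<bar> / 4 \<le> \<bar>\<Phi> (Suc n) q'\<bar>"
        unfolding quarter by auto
      then obtain q' where q': "q' \<in> ?Z" "\<bar>\<Phi> n q\<bar> / 4 \<le> \<bar>\<Phi> (Suc n) q'\<bar>" by blast
      have bnds: "fst q \<le> fst q' \<and> snd q \<le> snd q'
        \<and> fst q' + A' \<le> fst q + (A' + A') \<and> snd q' + B' \<le> snd q + (B' + B')"
        using q'(1) AB' by auto
      have "sq (Suc n) q' \<subseteq> sq n q"
        using bnds AB' unfolding sq_def A'_def[symmetric] B'_def[symmetric] AB'(1,2) by auto
      moreover have "\<bar>boundary_flux Q P t A x B\<bar> / 4^n / 4 \<le> \<bar>\<Phi> n q\<bar> / 4"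
        using that by (intro divide_right_mono) (auto simp: G_def)
      ultimately have "G (Suc n) q'"
        using q'(2) sub unfolding G_def by (auto simp: mult.commute)
      then show ?thesis
        using bnds unfolding A'_def[symmetric] B'_def[symmetric] AB'(1,2)
        by (intro exI[of _ q']) auto
    qed
    show ?thesis
      using dependent_nat_choice[of G "\<lambda>n q q'. fst q \<le> fst q' \<and> snd q \<le> snd q'
      \<and> fst q' + A/2^Suc n \<le> fst q + A/2^n \<and> snd q' + B/2^Suc n \<le> snd q + B/2^n"]
        G0 step by blast
  qed
  then obtain f where f: "\<And>n. G n (f n)"
    "\<And>n. fst (f n) \<le> fst (f (Suc n))" "\<And>n. snd (f n) \<le> snd (f (Suc n))"
    "\<And>n. fst (f (Suc n)) + A/2^Suc n \<le> fst (f n) + A/2^n"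
    "\<And>n. snd (f (Suc n)) + B/2^Suc n \<le> snd (f n) + B/2^n" by blast
  have lim0: "(\<lambda>n. C / 2^n) \<longlonglongrightarrow> 0" for C :: real
    by (rule LIMSEQ_divide_realpow_zero) simp
  \<comment> \<open>Lower corners increase, upper corners decrease and the side lengths tend to 0,
    so the nested rectangles share a point.\<close>
  obtain \<tau> where \<tau>: "\<And>n. fst (f n) \<le> \<tau>" "\<And>n. \<tau> \<le> fst (f n) + A/2^n"
    using nested_sequence_unique[of "\<lambda>n. fst (f n)" "\<lambda>n. fst (f n) + A/2^n"] f(2,4) AB
      tendsto_minus[OF lim0[of A]] by auto
  obtain \<xi> where \<xi>: "\<And>n. snd (f n) \<le> \<xi>" "\<And>n. \<xi> \<le> snd (f n) + B/2^n"
    using nested_sequence_unique[of "\<lambda>n. snd (f n)" "\<lambda>n. snd (f n) + B/2^n"] f(3,5) AB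
      tendsto_minus[OF lim0[of B]] by auto
  define p where "p = (\<tau>, \<xi>)"
  have psq: "p \<in> sq n (f n)" for n using \<tau> \<xi> by (simp add: p_def sq_def)
  have pR: "p \<in> R" using psq[of 0] f(1)[of 0] by (auto simp: G_def)
  obtain Q' P' where D: "(Q has_derivative Q') (at p)" "(P has_derivative P') (at p)"
    "Q' (1, 0) + P' (0, 1) = 0"
    using diff pR unfolding R_def by blast
  define c where "c = \<bar>boundary_flux Q P t A x B\<bar>"
  \<comment> \<open>Chosen so that \<open>2 * e * (A + B)\<^sup>2\<close> is \<open>c / 2\<close>:
    the flux of a small rectangle is then at most half of what \<open>G\<close> guarantees.\<close>
  define e where "e = c / (4 * (A + B)\<^sup>2)"
  have "c > 0" using ne by (simp add: c_def)
  have e: "e > 0" using \<open>c > 0\<close> AB by (simp add: e_def)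
  obtain d1 where d1: "d1 > 0" "\<And>z. norm (z - p) < d1 \<Longrightarrow> \<bar>Q z - Q p - Q' (z - p)\<bar> \<le> e * norm (z - p)"
    using D(1) e unfolding has_derivative_at_alt by auto
  obtain d2 where d2: "d2 > 0" "\<And>z. norm (z - p) < d2 \<Longrightarrow> \<bar>P z - P p - P' (z - p)\<bar> \<le> e * norm (z - p)"
    using D(2) e unfolding has_derivative_at_alt by auto
  obtain n where n: "(A + B) / 2^n < min d1 d2"
    using order_tendstoD(2)[OF lim0[of "A + B"], of "min d1 d2"] d1(1) d2(1)
    by (auto simp: eventually_sequentially)
  have close: "norm (z - p) < min d1 d2" if "z \<in> sq n (f n)" for z
  proof -
    have "norm (z - p) \<le> norm (fst z - fst p) + norm (snd z - snd p)"
      by (simp add: norm_prod_def sqrt_sum_squares_le_sum_abs)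
    also have "\<dots> \<le> A/2^n + B/2^n"
      using that psq[of n] by (intro add_mono) (auto simp: sq_def mem_Times_iff)
    also have "\<dots> < min d1 d2" using n by (simp add: add_divide_distrib)
    finally show ?thesis .
  qed
  have sub: "sq n (f n) \<subseteq> R" using f(1) by (simp add: G_def)
  have "\<bar>\<Phi> n (f n)\<bar> \<le> 2 * e * (A/2^n + B/2^n)\<^sup>2"
    unfolding \<Phi>_def
  proof (rule boundary_flux_small[of _ _ _ _ Q P p Q' P'])
    show "linear Q'" "linear P'" using D has_derivative_linear by blast+
  qed (use continuous_on_subset[OF cont(1) sub] continuous_on_subset[OF cont(2) sub] AB D(3) e
      psq[of n] d1(2) d2(2) close in \<open>auto simp: sq_def\<close>)
  also have "\<dots> = c / 2 / 4^n"
  proof -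
    have "(A/2^n + B/2^n)\<^sup>2 = (A + B)\<^sup>2 / 4^n"
      by (simp add: add_divide_distrib[symmetric] power_divide power_mult[symmetric] mult.commute[of n])
         (simp add: power_mult)
    then show ?thesis using AB by (simp add: e_def)
  qed
  also have "\<dots> < c / 4^n" using \<open>c > 0\<close> by (simp add: field_simps)
  finally show False using f(1)[of n] by (simp add: G_def c_def)
qed

section \<open>Transport of superlevel sets along straight lines\<close>

text \<open>A differentiable convex function has a continuous derivative: the tangent at
  \<open>U + h\<close> lies below the graph at \<open>U\<close> and at \<open>U + 2 * h\<close>, so
  \<open>deriv a (U + h)\<close> is trapped between the quotients \<open>m h\<close> and
  \<open>2 * m (2 * h) - m h\<close>, both of which tend to \<open>deriv a U\<close>.\<close>

lemma isCont_deriv_strictly_convex: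
  assumes conv: "strictly_convex a" and diff: "\<And>U. a differentiable (at U)"
  shows "isCont (deriv a) U"
proof -
  have D: "(a has_real_derivative deriv a x) (at x)" for x
    using diff[of x] by (metis DERIV_deriv_iff_real_differentiable)
  have cvx: "convex_on UNIV a"
  proof (rule convex_onI)
    fix s x y :: real assume "0 < s" "s < 1"
    show "a ((1 - s) *\<^sub>R x + s *\<^sub>R y) \<le> (1 - s) * a x + s * a y"
    proof (cases "x = y")
      case True
      have "(1 - s) *\<^sub>R x + s *\<^sub>R x = x" "(1 - s) * a x + s * a x = a x"
        by (simp_all add: algebra_simps)
      then show ?thesis using True by simp
    next
      case False
      then show ?thesis
        using conv \<open>0 < s\<close> \<open>s < 1\<close> by (auto simp: strictly_convex_def intro!: less_imp_le)
    qed
  qed auto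
  have tangent: "deriv a c * (x - c) \<le> a x - a c" for x c
    by (rule convex_on_imp_above_tangent[OF cvx]) (auto simp: D)
  define m where "m h = (a (U + h) - a U) / h" for h
  have m0: "(m \<longlongrightarrow> deriv a U) (at 0)"
    using D[of U] unfolding m_def DERIV_def .
  have m2: "((\<lambda>h. m (2 * h)) \<longlongrightarrow> deriv a U) (at 0)"
    by (rule filterlim_compose[OF m0])
       (auto simp: filterlim_at eventually_at_filter intro!: tendsto_eq_intros)
  have bound: "\<bar>deriv a (U + h) - m h\<bar> \<le> \<bar>2 * m (2 * h) - 2 * m h\<bar>" if "h \<noteq> 0" for h
  proof -
    have 1: "a (U + h) - a U \<le> deriv a (U + h) * h"
      using tangent[of "U + h" U] by simp
    have 2: "deriv a (U + h) * h \<le> a (U + 2 * h) - a (U + h)"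
      using tangent[of "U + h" "U + 2 * h"] by simp
    have "a (U + 2 * h) - a (U + h) = (2 * m (2 * h) - m h) * h" "a (U + h) - a U = m h * h"
      using that by (simp_all add: m_def field_simps)
    \<comment> \<open>Keeping the factor \<open>h\<close> treats both signs of \<open>h\<close> at
      once; dividing would reverse the inequalities for negative \<open>h\<close>.\<close>
    with 1 2 have "0 \<le> (deriv a (U + h) - m h) * h"
      "(deriv a (U + h) - m h) * h \<le> (2 * m (2 * h) - 2 * m h) * h"
      by (simp_all add: algebra_simps)
    then have "\<bar>(deriv a (U + h) - m h) * h\<bar> \<le> \<bar>(2 * m (2 * h) - 2 * m h) * h\<bar>"
      by linarith
    then show ?thesis using that by (simp add: abs_mult)
  qed
  have "((\<lambda>h. \<bar>2 * m (2 * h) - 2 * m h\<bar>) \<longlongrightarrow> 0) (at 0)"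
    by (rule tendsto_eq_intros m0 m2 refl | simp)+
  then have "((\<lambda>h. deriv a (U + h) - m h) \<longlongrightarrow> 0) (at 0)"
    by (rule tendsto_0_le[where K = 1]) (auto simp: eventually_at_filter bound)
  from tendsto_add[OF this m0] show ?thesis by (simp add: isCont_def LIM_offset_zero_iff)
qed

text \<open>To the left of \<open>U\<close> the integral is 0 because the interval is empty, and
  \<open>g\<close> is 0 there too, so the fundamental theorem of calculus holds two-sidedly on the
  whole line, also at \<open>U\<close>.\<close>

lemma has_real_derivative_integral_from:
  fixes g :: "real \<Rightarrow> real"
  assumes g: "continuous_on UNIV g" and z: "\<And>r. r \<le> U \<Longrightarrow> g r = 0"
  shows "((\<lambda>s. integral {U..s} g) has_real_derivative g s) (at s)"
proof (cases "s < U")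
  case True
  have "((\<lambda>s. 0) has_real_derivative g s) (at s)" using z[of s] True by simp
  then show ?thesis
  proof (rule has_field_derivative_transform_within_open[of _ _ _ "{..<U}"])
  qed (use True in auto)
next
  case False
  have int: "g integrable_on {p..q}" for p q
    by (rule integrable_continuous_real[OF continuous_on_subset[OF g]]) auto
  \<comment> \<open>Starting at \<open>U - 1\<close> makes \<open>s\<close> an interior point even
    for \<open>s = U\<close>; the additional piece of the integral is 0.\<close>
  have "((\<lambda>s. integral {U - 1..s} g) has_real_derivative g s) (at s within {U - 1..s + 1})"
    using False g by (intro integral_has_real_derivative continuous_on_subset[OF g]) auto
  then have "((\<lambda>s. integral {U - 1..s} g) has_real_derivative g s) (at s)"
    using False by (subst (asm) at_within_interior) auto
  then show ?thesis
  proof (rule has_field_derivative_transform_within_open[of _ _ _ "{U - 1<..}"])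
    fix r assume r: "r \<in> {U - 1<..}"
    have zero: "integral {p..q} g = 0" if "q \<le> U" for p q
    proof -
      have "integral {p..q} g = integral {p..q} (\<lambda>_. 0)"
        using that z by (intro Henstock_Kurzweil_Integration.integral_cong) auto
      then show ?thesis by simp
    qed
    show "integral {U - 1..r} g = integral {U..r} g"
    proof (cases "r \<le> U")
      case True
      then show ?thesis by (simp add: zero)
    next
      case False
      then show ?thesis
        using Henstock_Kurzweil_Integration.integral_combine[of "U - 1" U r g] int zero[of U "U - 1"]
        by simp
    qed
  qed (use False in auto)
qed

text \<open>
  A smooth step function \<open>\<eta>\<close> at \<open>U\<close> with a flux \<open>q\<close> for it: \<open>q\<close> is small since \<open>\<eta>'\<close> is supported
  where the speed \<open>b\<close> is close to \<open>c\<close>.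
\<close>

lemma step_entropy:
  fixes b :: "real \<Rightarrow> real"
  assumes b: "continuous_on UNIV b" and "0 < e"
    and m: "\<And>r. U \<le> r \<Longrightarrow> r \<le> U + e \<Longrightarrow> \<bar>b r - c\<bar> \<le> m"
  obtains \<eta> \<beta> q where
    "\<And>s. (\<eta> has_real_derivative \<beta> s) (at s)"
    "\<And>s. (q has_real_derivative \<beta> s * (b s - c)) (at s)"
    "\<And>s. 0 \<le> \<eta> s" "\<And>s. \<eta> s \<le> 1" "\<And>s. s \<le> U \<Longrightarrow> \<eta> s = 0" "\<And>s. U + e \<le> s \<Longrightarrow> \<eta> s = 1"
    "\<And>s. \<bar>q s\<bar> \<le> m"
proof -
  \<comment> \<open>A tent over the interval from \<open>U\<close> to \<open>U + e\<close>. It is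
    continuous and vanishes at both ends, so its primitive is differentiable everywhere and constant
    outside the interval.\<close>
  define g where "g r = max 0 (min (r - U) (U + e - r))" for r
  define N where "N s = integral {U..s} g" for s
  define R where "R s = integral {U..s} (\<lambda>r. g r * (b r - c))" for s
  have gc: "continuous_on S g" for S unfolding g_def by (intro continuous_intros)
  have gbc: "continuous_on S (\<lambda>r. g r * (b r - c))" for S
    by (intro continuous_intros gc continuous_on_subset[OF b]) auto
  have g0: "g r = 0" if "r \<le> U \<or> U + e \<le> r" for r using that \<open>0 < e\<close> by (auto simp: g_def)
  have gn: "0 \<le> g r" for r by (simp add: g_def)
  have gi: "g integrable_on {p..q}" for p q
    by (intro integrable_continuous_real gc)
  have gbi: "(\<lambda>r. g r * (b r - c)) integrable_on {p..q}" for p q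
    by (intro integrable_continuous_real gbc)
  have N': "(N has_real_derivative g s) (at s)" for s
    unfolding N_def[abs_def] by (intro has_real_derivative_integral_from gc g0) auto
  have R': "(R has_real_derivative g s * (b s - c)) (at s)" for s
    unfolding R_def[abs_def] by (intro has_real_derivative_integral_from gbc) (simp add: g0)
  \<comment> \<open>The mass of the tent; division by it makes the primitive rise from 0 to exactly
    1.\<close>
  define \<kappa> where "\<kappa> = N (U + e)"
  have N0: "N s = 0" if "s \<le> U" for s using that unfolding N_def by (cases "s = U") auto
  have Nn: "0 \<le> N s" for s unfolding N_def by (intro Henstock_Kurzweil_Integration.integral_nonneg gi gn)
  have N1: "N s = \<kappa>" if "U + e \<le> s" for s
  proof -
    have "integral {U + e..s} g = integral {U + e..s} (\<lambda>_. 0)"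
      by (intro Henstock_Kurzweil_Integration.integral_cong) (auto simp: g0)
    then show ?thesis
      using Henstock_Kurzweil_Integration.integral_combine[of U "U + e" s g] gi that \<open>0 < e\<close>
      by (simp add: N_def \<kappa>_def)
  qed
  have Nle: "N s \<le> \<kappa>" for s
  proof (cases "s \<le> U + e")
    case True
    then show ?thesis unfolding N_def \<kappa>_def by (intro integral_subset_le gi) (auto simp: gn)
  qed (simp add: N1)
  have "\<kappa> \<noteq> 0"
  proof
    assume "\<kappa> = 0"
    then have "(g has_integral 0) (cbox U (U + e))"
      using gi[of U "U + e"] by (simp add: \<kappa>_def N_def has_integral_iff)
    from has_integral_0_cbox_imp_0[OF gc gn this, of "U + e/2"] \<open>0 < e\<close>
    show False by (auto simp: g_def)
  qed
  with Nn[of "U + e"] have \<kappa>: "0 < \<kappa>" by (simp add: \<kappa>_def)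
  have m0: "0 \<le> m" using m[of U] \<open>0 < e\<close> by force
  \<comment> \<open>The speed bound is available only on the support of the tent, but nothing else
    enters the integral. Together with \<open>N s \<le> \<kappa>\<close> it gives the bound
    \<open>m\<close> after normalisation.\<close>
  have Rb: "\<bar>R s\<bar> \<le> m * N s" for s
  proof -
    have "norm (R s) \<le> integral {U..s} (\<lambda>r. m * g r)"
      unfolding R_def
    proof (rule integral_norm_bound_integral[OF gbi])
      fix r assume "r \<in> {U..s}"
      then show "norm (g r * (b r - c)) \<le> m * g r"
        using m[of r] gn[of r] g0[of r] by (cases "r \<le> U + e") (auto simp: abs_mult mult.commute[of m] intro!: mult_left_mono)
    qed (intro integrable_continuous_real continuous_intros gc)
    then show ?thesis by (simp add: N_def)
  qed
  show ?thesis
  proof (rule that[of "\<lambda>s. N s / \<kappa>" "\<lambda>s. g s / \<kappa>" "\<lambda>s. R s / \<kappa>"])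
    show "((\<lambda>s. N s / \<kappa>) has_real_derivative g s / \<kappa>) (at s)" for s
      by (intro DERIV_cdivide N')
    show "((\<lambda>s. R s / \<kappa>) has_real_derivative g s / \<kappa> * (b s - c)) (at s)" for s
      using DERIV_cdivide[OF R'[of s], of \<kappa>] by simp
    show "\<bar>R s / \<kappa>\<bar> \<le> m" for s
    proof -
      have "\<bar>R s\<bar> \<le> m * \<kappa>"
        using Rb[of s] mult_left_mono[OF Nle[of s] m0] by linarith
      then show ?thesis using \<kappa> by (simp add: field_simps)
    qed
  qed (use \<kappa> Nn Nle N0 N1 in auto)
qed

text \<open>The quasilinear form of the law, with \<open>b\<close> in the role of \<open>a'\<close>.
  It is stated with the total derivative because the solution is composed with a shear of the plane
  and with step functions, which the chain rule then handles directly.\<close>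

definition characteristic_form :: "(real \<Rightarrow> real) \<Rightarrow> real \<Rightarrow> (real \<Rightarrow> real \<Rightarrow> real) \<Rightarrow> bool" where
  "characteristic_form b T v \<longleftrightarrow> (\<forall>t\<in>{0<..<T}. \<forall>x. \<exists>D.
     ((\<lambda>(s, y). v s y) has_derivative D) (at (t, x)) \<and> D (1, 0) + b (v t x) * D (0, 1) = 0)"

lemma characteristic_form_slice_continuous:
  assumes "characteristic_form b T v" "t \<in> {0<..<T}"
  shows "continuous_on S (\<lambda>y. v t (y + z))"
proof -
  have "isCont (\<lambda>y. v t (y + z)) y" for y
  proof -
    obtain D where "((\<lambda>(s, y). v s y) has_derivative D) (at (t, y + z))"
      using assms unfolding characteristic_form_def by blast
    then have "isCont (\<lambda>(s, y). v s y) (t, y + z)" by (rule has_derivative_continuous)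
    moreover have "isCont (\<lambda>y. (t, y + z)) y" by (intro continuous_intros)
    ultimately show ?thesis using isCont_o2[of y "\<lambda>y. (t, y + z)" "\<lambda>(s, y). v s y"] by simp
  qed
  then show ?thesis by (simp add: continuous_at_imp_continuous_on)
qed

text \<open>In the sheared coordinates the field formed by \<open>\<eta> \<circ> V\<close> and
  \<open>q \<circ> V\<close> is divergence free, so the change of the integral of
  \<open>\<eta>\<close> between \<open>t0\<close> and \<open>t1\<close> equals the flux through the
  two sides \<open>y0\<close> and \<open>y1\<close>. Each side contributes at most \<open>m\<close>
  per unit of time, hence the factor 2.\<close>

lemma characteristic_form_step_flux:
  assumes v: "characteristic_form b T v" and b: "continuous_on UNIV b"
    and t: "0 < t0" "t0 < t1" "t1 < T" and y: "y0 < y1" and "0 < e"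
    and m: "\<And>r. U \<le> r \<Longrightarrow> r \<le> U + e \<Longrightarrow> \<bar>b r - c\<bar> \<le> m"
  shows "\<exists>\<eta>. continuous_on UNIV \<eta> \<and> (\<forall>s. 0 \<le> \<eta> s \<and> \<eta> s \<le> 1) \<and> (\<forall>s\<le>U. \<eta> s = 0) \<and>
    (\<forall>s\<ge>U + e. \<eta> s = 1) \<and>
    \<bar>integral {y0..y1} (\<lambda>y. \<eta> (v t1 (y + c * t1)) - \<eta> (v t0 (y + c * t0)))\<bar> \<le> 2 * m * (t1 - t0)"
proof -
  obtain \<eta> \<beta> q where E: "\<And>s. (\<eta> has_real_derivative \<beta> s) (at s)"
    "\<And>s. (q has_real_derivative \<beta> s * (b s - c)) (at s)"
    "\<And>s. 0 \<le> \<eta> s" "\<And>s. \<eta> s \<le> 1" "\<And>s. s \<le> U \<Longrightarrow> \<eta> s = 0" "\<And>s. U + e \<le> s \<Longrightarrow> \<eta> s = 1"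
    "\<And>s. \<bar>q s\<bar> \<le> m"
    using step_entropy[OF b \<open>0 < e\<close> m] by blast
  define V where "V z = v (fst z) (snd z + c * fst z)" for z
  have D: "\<exists>Q' P'. ((\<eta> \<circ> V) has_derivative Q') (at z) \<and> ((q \<circ> V) has_derivative P') (at z) \<and>
     Q' (1, 0) + P' (0, 1) = 0" if z: "fst z \<in> {t0..t1}" for z
  proof -
    obtain D where D: "((\<lambda>(s, y). v s y) has_derivative D) (at (fst z, snd z + c * fst z))"
      and D0: "D (1, 0) + b (V z) * D (0, 1) = 0"
      using v z t unfolding characteristic_form_def V_def by force
    \<comment> \<open>The shear that brings the lines of speed \<open>c\<close> to rest; being
      linear, it is its own derivative.\<close>
    define L :: "real \<times> real \<Rightarrow> real \<times> real" where "L z = (fst z, snd z + c * fst z)" for z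
    have "(L has_derivative L) (at z)"
      unfolding L_def[abs_def] by (auto intro!: derivative_eq_intros)
    moreover have "((\<lambda>(s, y). v s y) has_derivative D) (at (L z))" using D by (simp add: L_def)
    ultimately have "((\<lambda>(s, y). v s y) \<circ> L has_derivative D \<circ> L) (at z)"
      by (rule diff_chain_at)
    then have V': "(V has_derivative (\<lambda>h. D (L h))) (at z)"
      by (simp add: V_def[abs_def] L_def o_def)
    have \<eta>': "(\<eta> has_derivative (\<lambda>h. \<beta> (V z) * h)) (at (V z))"
      and q': "(q has_derivative (\<lambda>h. \<beta> (V z) * (b (V z) - c) * h)) (at (V z))"
      using E(1,2) by (auto simp: has_field_derivative_def)
    have lin: "linear D" using D by (rule has_derivative_linear)
    have "D (1, c) = D ((1, 0) + c *\<^sub>R (0, 1))" by simp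
    also have "\<dots> = D (1, 0) + c * D (0, 1)"
      unfolding linear_add[OF lin] linear_scale[OF lin] by simp
    \<comment> \<open>Shearing adds \<open>c\<close> times the space derivative to the time
      derivative; subtracting \<open>c\<close> from the speed compensates this, which leaves the
      original equation.\<close>
    finally have "D (L (1, 0)) + (b (V z) - c) * D (L (0, 1)) = 0"
      using D0 by (simp add: L_def algebra_simps)
    then have "\<beta> (V z) * D (L (1, 0)) + \<beta> (V z) * (b (V z) - c) * D (L (0, 1)) = 0"
      by (simp only: mult.assoc distrib_left[symmetric] mult_zero_right)
    with diff_chain_at[OF V' \<eta>'] diff_chain_at[OF V' q'] show ?thesis
      by (auto simp: o_def)
  qed
  have "boundary_flux (\<eta> \<circ> V) (q \<circ> V) t0 (t1 - t0) y0 (y1 - y0) = 0"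
    using D t y by (intro boundary_flux_eq_0) auto
  then have "integral {y0..y1} (\<lambda>y. \<eta> (v t1 (y + c * t1)) - \<eta> (v t0 (y + c * t0))) =
     - integral {t0..t1} (\<lambda>s. q (V (s, y1)) - q (V (s, y0)))"
    by (simp add: boundary_flux_def V_def)
  moreover have "norm (integral {t0..t1} (\<lambda>s. q (V (s, y1)) - q (V (s, y0)))) \<le> 2 * m * (t1 - t0)"
  proof (rule integral_bound)
    show "continuous_on {t0..t1} (\<lambda>s. q (V (s, y1)) - q (V (s, y0)))"
    proof (intro continuous_on_diff continuous_at_imp_continuous_on ballI)
      have *: "isCont (\<lambda>s. q (V (s, y))) s" if "s \<in> {t0..t1}" for s y
      proof -
      have "isCont (q \<circ> V) (s, y)" using that D[of "(s, y)"] has_derivative_continuous by fastforce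
      moreover have "isCont (\<lambda>s. (s, y)) s" by (intro continuous_intros)
      ultimately show ?thesis
        using isCont_o2[of s "\<lambda>s. (s, y)" "q \<circ> V"] by simp
      qed
      show "isCont (\<lambda>s. q (V (s, y1))) s" "isCont (\<lambda>s. q (V (s, y0))) s" if "s \<in> {t0..t1}" for s
        using that by (rule *)+
    qed
    show "norm (q (V (s, y1)) - q (V (s, y0))) \<le> 2 * m" for s
      using E(7)[of "V (s, y1)"] E(7)[of "V (s, y0)"] by simp
  qed (use t in auto)
  moreover have "continuous_on UNIV \<eta>"
    using E(1) by (meson DERIV_isCont continuous_at_imp_continuous_on)
  ultimately show ?thesis using E(3-6) by (intro exI[of _ \<eta>]) auto
qed

text \<open>Steps of width at most \<open>1 / Suc n\<close> that vanish up to \<open>U\<close>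
  converge pointwise to the indicator of the open ray above \<open>U\<close>, while continuity of
  \<open>b\<close> at \<open>U\<close> makes their fluxes tend to 0. Dominated convergence carries
  the balance to the limit.\<close>

lemma characteristic_form_superlevel_const:
  assumes v: "characteristic_form b T v" and b: "continuous_on UNIV b"
    and t: "0 < t0" "t0 < t1" "t1 < T" and y: "y0 < y1"
  shows "(LBINT y:{y0..y1}. indicator {U<..} (v t1 (y + b U * t1)) :: real) =
         (LBINT y:{y0..y1}. indicator {U<..} (v t0 (y + b U * t0)))"
proof -
  have ex: "\<forall>n. \<exists>\<eta>. continuous_on UNIV \<eta> \<and> (\<forall>s. 0 \<le> \<eta> s \<and> \<eta> s \<le> 1) \<and> (\<forall>s\<le>U. \<eta> s = 0) \<and>
    (\<forall>s\<ge>U + 1 / Suc n. \<eta> s = 1) \<and>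
    \<bar>integral {y0..y1} (\<lambda>y. \<eta> (v t1 (y + b U * t1)) - \<eta> (v t0 (y + b U * t0)))\<bar>
      \<le> 2 * (1 / Suc n) * (t1 - t0)"
  proof
    fix n :: nat
    have "isCont b U" using b by (simp add: continuous_on_eq_continuous_at)
    then obtain d where d: "d > 0" "\<And>r. \<bar>r - U\<bar> < d \<Longrightarrow> \<bar>b r - b U\<bar> < 1 / Suc n"
      unfolding continuous_at_eps_delta dist_real_def
      by (metis of_nat_0_less_iff zero_less_Suc zero_less_divide_1_iff)
    \<comment> \<open>Half of \<open>d\<close> keeps the closed interval from \<open>U\<close> to
      \<open>U + e\<close> inside the neighbourhood where \<open>b\<close> is close to
      \<open>b U\<close>; the other term ensures that the step has reached 1 at
      \<open>U + 1 / Suc n\<close>.\<close>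
    define e where "e = min (d/2) (1 / Suc n)"
    have "e > 0" using d by (simp add: e_def)
    have near: "\<bar>b r - b U\<bar> \<le> 1 / Suc n" if "U \<le> r" "r \<le> U + e" for r
      using d(2)[of r] d(1) that by (auto simp: e_def min_def split: if_splits)
    have "\<exists>\<eta>. continuous_on UNIV \<eta> \<and> (\<forall>s. 0 \<le> \<eta> s \<and> \<eta> s \<le> 1) \<and> (\<forall>s\<le>U. \<eta> s = 0) \<and>
      (\<forall>s\<ge>U + e. \<eta> s = 1) \<and>
      \<bar>integral {y0..y1} (\<lambda>y. \<eta> (v t1 (y + b U * t1)) - \<eta> (v t0 (y + b U * t0)))\<bar>
        \<le> 2 * (1 / Suc n) * (t1 - t0)"
      by (rule characteristic_form_step_flux[OF v b t y \<open>e > 0\<close>]) (rule near)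
    then obtain \<eta> where "continuous_on UNIV \<eta>" "\<forall>s. 0 \<le> \<eta> s \<and> \<eta> s \<le> 1" "\<forall>s\<le>U. \<eta> s = 0"
      "\<forall>s\<ge>U + e. \<eta> s = 1"
      "\<bar>integral {y0..y1} (\<lambda>y. \<eta> (v t1 (y + b U * t1)) - \<eta> (v t0 (y + b U * t0)))\<bar>
        \<le> 2 * (1 / Suc n) * (t1 - t0)"
      by (elim exE conjE)
    moreover have "U + e \<le> s" if "U + 1 / Suc n \<le> s" for s using that by (simp add: e_def)
    ultimately show "\<exists>\<eta>. continuous_on UNIV \<eta> \<and> (\<forall>s. 0 \<le> \<eta> s \<and> \<eta> s \<le> 1) \<and>
        (\<forall>s\<le>U. \<eta> s = 0) \<and> (\<forall>s\<ge>U + 1 / Suc n. \<eta> s = 1) \<and>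
        \<bar>integral {y0..y1} (\<lambda>y. \<eta> (v t1 (y + b U * t1)) - \<eta> (v t0 (y + b U * t0)))\<bar>
          \<le> 2 * (1 / Suc n) * (t1 - t0)"
      by (intro exI[of _ \<eta>] conjI) auto
  qed
  from choice[OF ex] obtain \<eta> where H: "\<forall>n. continuous_on UNIV (\<eta> n) \<and> (\<forall>s. 0 \<le> \<eta> n s \<and> \<eta> n s \<le> 1) \<and>
    (\<forall>s\<le>U. \<eta> n s = 0) \<and> (\<forall>s\<ge>U + 1 / Suc n. \<eta> n s = 1) \<and>
    \<bar>integral {y0..y1} (\<lambda>y. \<eta> n (v t1 (y + b U * t1)) - \<eta> n (v t0 (y + b U * t0)))\<bar>
      \<le> 2 * (1 / Suc n) * (t1 - t0)" ..
  have \<eta>: "continuous_on UNIV (\<eta> n)" "0 \<le> \<eta> n s" "\<eta> n s \<le> 1"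
    "s \<le> U \<Longrightarrow> \<eta> n s = 0" "U + 1 / Suc n \<le> s \<Longrightarrow> \<eta> n s = (1::real)"
    and flux: "\<bar>integral {y0..y1} (\<lambda>y. \<eta> n (v t1 (y + b U * t1)) - \<eta> n (v t0 (y + b U * t0)))\<bar>
      \<le> 2 * (1 / Suc n) * (t1 - t0)" for n s
    using spec[OF H, of n] by auto
  have lim: "(\<lambda>n. \<eta> n s) \<longlonglongrightarrow> indicator {U<..} s" for s
  proof (cases "s \<le> U")
    case False
    then have "eventually (\<lambda>n. 1 / real (Suc n) < s - U) sequentially"
      using order_tendstoD(2)[OF lim_1_over_n[THEN LIMSEQ_Suc], of "s - U"] by simp
    then have "eventually (\<lambda>n. \<eta> n s = 1) sequentially"
      by eventually_elim (auto intro!: \<eta>(5))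
    then show ?thesis using False by (simp add: tendsto_eventually)
  qed (simp add: \<eta>(4))
  have vc: "continuous_on S (\<lambda>y. v t (y + b U * t))" if "t \<in> {t0, t1}" for t S
    using that t by (intro characteristic_form_slice_continuous[OF v]) auto
  have \<eta>c: "continuous_on S (\<lambda>y. \<eta> n (v t (y + b U * t)))" if "t \<in> {t0, t1}" for t n S
    using continuous_on_compose2[OF \<eta>(1) vc[OF that]] by auto
  have si: "set_integrable lborel {y0..y1} (\<lambda>y. \<eta> n (v t (y + b U * t)))" if "t \<in> {t0, t1}" for t n
    using \<eta>c[OF that] by (intro borel_integrable_atLeastAtMost')
  have conv: "(\<lambda>n. integral {y0..y1} (\<lambda>y. \<eta> n (v t (y + b U * t))))
     \<longlonglongrightarrow> (LBINT y:{y0..y1}. indicator {U<..} (v t (y + b U * t)))" if "t \<in> {t0, t1}" for t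
  proof -
    have [measurable]: "(\<lambda>y. v t (y + b U * t)) \<in> borel_measurable borel"
      "\<And>n. (\<lambda>y. \<eta> n (v t (y + b U * t))) \<in> borel_measurable borel"
      using vc[OF that] \<eta>c[OF that] by (auto intro!: borel_measurable_continuous_onI)
    have "(\<lambda>n. LBINT y:{y0..y1}. \<eta> n (v t (y + b U * t)))
      \<longlonglongrightarrow> (LBINT y:{y0..y1}. indicator {U<..} (v t (y + b U * t)))"
      unfolding set_lebesgue_integral_def
    proof (rule integral_dominated_convergence[where w = "indicator {y0..y1}"])
      show "AE y in lborel. (\<lambda>n. indicator {y0..y1} y *\<^sub>R \<eta> n (v t (y + b U * t)))
         \<longlonglongrightarrow> indicator {y0..y1} y *\<^sub>R indicator {U<..} (v t (y + b U * t))"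
        by (intro AE_I2 tendsto_scaleR tendsto_const lim)
      show "AE y in lborel. norm (indicator {y0..y1} y *\<^sub>R \<eta> n (v t (y + b U * t))) \<le> indicator {y0..y1} y"
        for n using \<eta>(2,3) by (auto simp: indicator_def)
    qed (auto intro!: integrable_real_indicator simp: emeasure_lborel_Icc_eq)
    then show ?thesis using set_borel_integral_eq_integral(2)[OF si[OF that]] by simp
  qed
  have "(\<lambda>n. integral {y0..y1} (\<lambda>y. \<eta> n (v t1 (y + b U * t1)) - \<eta> n (v t0 (y + b U * t0)))) \<longlonglongrightarrow> 0"
  proof (rule tendsto_0_le[where K = "2 * (t1 - t0)"])
    show "(\<lambda>n. 1 / real (Suc n)) \<longlonglongrightarrow> 0" by (rule LIMSEQ_Suc[OF lim_1_over_n])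
  qed (use flux t in \<open>auto simp: mult_ac\<close>)
  moreover have "integral {y0..y1} (\<lambda>y. \<eta> n (v t1 (y + b U * t1)) - \<eta> n (v t0 (y + b U * t0))) =
    integral {y0..y1} (\<lambda>y. \<eta> n (v t1 (y + b U * t1))) - integral {y0..y1} (\<lambda>y. \<eta> n (v t0 (y + b U * t0)))" for n
    by (intro Henstock_Kurzweil_Integration.integral_diff integrable_continuous_real \<eta>c) auto
  ultimately show ?thesis
    using LIMSEQ_unique[OF _ tendsto_diff[OF conv[of t1] conv[of t0]], of 0] by simp
qed

section \<open>Random solutions\<close>

lemma borel_measurable_fst_real: "fst \<in> borel_measurable (borel :: (real \<times> real) measure)"
  and borel_measurable_snd_real: "snd \<in> borel_measurable (borel :: (real \<times> real) measure)"
  by (auto intro!: borel_measurable_continuous_onI continuous_intros)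

text \<open>Rounding the point down to the grid of mesh \<open>1 / Suc n\<close> leaves countably
  many measurable sections, hence a jointly measurable function; by continuity in the point these
  functions converge to \<open>g\<close>.\<close>

lemma borel_measurable_Caratheodory:
  fixes g :: "real \<times> real \<Rightarrow> 'w \<Rightarrow> real"
  assumes meas: "\<And>p. g p \<in> borel_measurable M"
    and cont: "\<And>w. w \<in> space M \<Longrightarrow> continuous_on UNIV (\<lambda>p. g p w)"
  shows "(\<lambda>(p, w). g p w) \<in> borel_measurable (borel \<Otimes>\<^sub>M M)"
proof -
  define k where "k n s = \<lfloor>real (Suc n) * s\<rfloor>" for n s
  define r where "r n s = of_int (k n s) / real (Suc n)" for n s
  have rlim: "(\<lambda>n. r n s) \<longlonglongrightarrow> s" for s
  proof -
    have "\<bar>r n s - s\<bar> \<le> 1 / real (Suc n)" for n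
    proof -
      have "r n s - s = (of_int \<lfloor>real (Suc n) * s\<rfloor> - real (Suc n) * s) / real (Suc n)"
        unfolding r_def k_def by (simp add: field_simps del: of_nat_Suc)
      moreover have "\<bar>of_int \<lfloor>real (Suc n) * s\<rfloor> - real (Suc n) * s\<bar> \<le> 1" by linarith
      ultimately show ?thesis by (simp add: divide_right_mono del: of_nat_Suc)
    qed
    then have "(\<lambda>n. r n s - s) \<longlonglongrightarrow> 0"
      by (intro tendsto_0_le[OF LIMSEQ_Suc[OF lim_1_over_n[where 'a = real]], where K = 1])
        (auto intro!: always_eventually)
    then show ?thesis by (rule LIM_zero_cancel)
  qed
  show ?thesis
  proof (rule borel_measurable_LIMSEQ_metric)
    fix n
    have k_meas: "k n \<in> measurable borel (count_space UNIV)"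
      unfolding k_def by measurable
    note k_fst = measurable_compose[OF measurable_compose[OF measurable_fst borel_measurable_fst_real] k_meas]
    note k_snd = measurable_compose[OF measurable_compose[OF measurable_fst borel_measurable_snd_real] k_meas]
    \<comment> \<open>The countable case distinction is made one coordinate at a time: here the
      first grid index is frozen at \<open>i\<close> and the second one varies.\<close>
    have m: "(\<lambda>z :: (real \<times> real) \<times> 'w. g (of_int i / real (Suc n), r n (snd (fst z))) (snd z))
        \<in> borel_measurable (borel \<Otimes>\<^sub>M M)" for i
      unfolding r_def
    proof (rule measurable_compose_countable[where g = "\<lambda>z :: (real \<times> real) \<times> 'w. k n (snd (fst z))" and
          f = "\<lambda>j z. g (of_int i / real (Suc n), of_int j / real (Suc n)) (snd z)"])
      show "(\<lambda>z. g (of_int i / real (Suc n), of_int j / real (Suc n)) (snd z))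
          \<in> borel_measurable (borel \<Otimes>\<^sub>M M)" for j
        by (rule measurable_compose[OF measurable_snd meas])
    qed (rule k_snd)
    have "(\<lambda>z :: (real \<times> real) \<times> 'w. g (of_int (k n (fst (fst z))) / real (Suc n), r n (snd (fst z))) (snd z))
        \<in> borel_measurable (borel \<Otimes>\<^sub>M M)"
      by (rule measurable_compose_countable[where g = "\<lambda>z :: (real \<times> real) \<times> 'w. k n (fst (fst z))" and
          f = "\<lambda>i z. g (of_int i / real (Suc n), r n (snd (fst z))) (snd z)", OF m])
        (rule k_fst)
    then show "(\<lambda>z. g (r n (fst (fst z)), r n (snd (fst z))) (snd z)) \<in> borel_measurable (borel \<Otimes>\<^sub>M M)"
      by (simp only: r_def)
  next
    fix z :: "(real \<times> real) \<times> 'w" assume z: "z \<in> space (borel \<Otimes>\<^sub>M M)"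
    obtain s y w where z_eq: "z = ((s, y), w)" by (metis prod.exhaust_sel)
    have "isCont (\<lambda>p. g p w) (s, y)"
      using cont[of w] z by (simp add: z_eq space_pair_measure continuous_on_eq_continuous_at)
    moreover have "(\<lambda>n. (r n s, r n y)) \<longlonglongrightarrow> (s, y)" by (intro tendsto_Pair rlim)
    ultimately have "(\<lambda>n. g (r n s, r n y) w) \<longlonglongrightarrow> g (s, y) w"
      by (rule isCont_tendsto_compose)
    then show "(\<lambda>n. g (r n (fst (fst z)), r n (snd (fst z))) (snd z)) \<longlonglongrightarrow> (case z of (p, w) \<Rightarrow> g p w)"
      by (simp add: z_eq)
  qed
qed

text \<open>Truncated to the interval from \<open>- real n\<close> to \<open>real n\<close>, both
  functions are densities of finite measures. These agree on all rays, so they coincide, and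
  densities are unique almost everywhere.\<close>

lemma AE_eq_of_interval_integrals:
  fixes g h :: "real \<Rightarrow> real"
  assumes [measurable]: "g \<in> borel_measurable borel" "h \<in> borel_measurable borel"
    and bnd: "\<And>y. 0 \<le> g y" "\<And>y. g y \<le> 1" "\<And>y. 0 \<le> h y" "\<And>y. h y \<le> 1"
    and eq: "\<And>p q. p < q \<Longrightarrow> (LBINT y:{p..q}. g y) = (LBINT y:{p..q}. h y)"
  shows "AE y in lborel. g y = h y"
proof -
  have em: "emeasure (density lborel (\<lambda>y. ennreal (indicator {- real n..real n} y * k y))) {x<..}
      = (if x < real n then ennreal (LBINT y:{max x (- real n)..real n}. k y) else 0)"
    if [measurable]: "k \<in> borel_measurable borel" and k: "\<And>y. 0 \<le> k y" "\<And>y. k y \<le> 1" for k n x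
  proof -
    have "emeasure (density lborel (\<lambda>y. ennreal (indicator {- real n..real n} y * k y))) {x<..}
      = (\<integral>\<^sup>+ y. ennreal (indicator {- real n..real n} y * k y) * indicator {x<..} y \<partial>lborel)"
      by (rule emeasure_density) auto
    \<comment> \<open>The ray is open at \<open>x\<close> while the interval is closed; they differ
      in a single point, a null set.\<close>
    also have "\<dots> = (\<integral>\<^sup>+ y. ennreal (indicator (if x < real n then {max x (- real n)..real n} else {}) y *\<^sub>R k y) \<partial>lborel)"
      by (rule nn_integral_cong_AE, use AE_lborel_singleton[of x] in eventually_elim)
         (auto simp: indicator_def)
    also have "\<dots> = ennreal (LBINT y:(if x < real n then {max x (- real n)..real n} else {}). k y)"
      unfolding set_lebesgue_integral_def
    proof (rule nn_integral_eq_integral)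
      show "integrable lborel (\<lambda>y. indicator (if x < real n then {max x (- real n)..real n} else {}) y *\<^sub>R k y)"
        by (rule integrableI_bounded_set[where A = "{- real n..real n}" and B = 1])
           (auto simp: indicator_def k)
    qed (simp add: k)
    finally show ?thesis by (simp add: set_lebesgue_integral_def)
  qed
  have "AE y in lborel. ennreal (indicator {- real n..real n} y * g y) = ennreal (indicator {- real n..real n} y * h y)" for n
  proof (rule sigma_finite_measure.density_unique[OF sigma_finite_lborel])
    show "density lborel (\<lambda>y. ennreal (indicator {- real n..real n} y * g y)) =
      density lborel (\<lambda>y. ennreal (indicator {- real n..real n} y * h y))"
    proof (rule measure_eqI_lessThan)
      fix x
      show "emeasure (density lborel (\<lambda>y. ennreal (indicator {- real n..real n} y * g y))) {x<..}
        = emeasure (density lborel (\<lambda>y. ennreal (indicator {- real n..real n} y * h y))) {x<..}"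
      proof (cases "max x (- real n) < real n")
        case True then show ?thesis by (simp add: em bnd eq)
      next
        \<comment> \<open>Here the interval has at most one point, so the hypothesis on proper
          intervals does not apply and both integrals are 0.\<close>
        case False
        have zero: "(LBINT y:{p..q}. k y) = 0" if "q \<le> p" for p q :: real and k :: "real \<Rightarrow> real"
          unfolding set_lebesgue_integral_def
          by (rule integral_eq_zero_AE, use AE_lborel_singleton[of p] in eventually_elim)
             (use that in \<open>auto simp: indicator_def\<close>)
        have "real n \<le> max x (- real n)" using False by linarith
        from zero[OF this, of g] zero[OF this, of h] show ?thesis by (simp add: em bnd)
      qed
    qed (simp_all add: em bnd)
  qed auto
  then have "AE y in lborel. \<forall>n. ennreal (indicator {- real n..real n} y * g y) = ennreal (indicator {- real n..real n} y * h y)"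
    by (simp add: AE_all_countable)
  then show ?thesis
  proof eventually_elim
    case (elim y)
    obtain n where "\<bar>y\<bar> \<le> real n" using real_arch_simple by blast
    then have "y \<in> {- real n..real n}" by auto
    with spec[OF elim, of n] show ?case using bnd by simp
  qed
qed

text \<open>Continuity and the equation hold for every outcome, and continuity on the whole plane,
  so that joint measurability follows without exceptional sets.
  \<open>no_shocks_random_solution\<close> supplies such a version of the given solution.\<close>

locale random_solution = prob_space M for M :: "'w measure" +
  fixes b :: "real \<Rightarrow> real" and T :: real and v :: "real \<Rightarrow> real \<Rightarrow> 'w \<Rightarrow> real"
  assumes meas: "v t x \<in> borel_measurable M"
    and cont: "w \<in> space M \<Longrightarrow> continuous_on UNIV (\<lambda>p. v (fst p) (snd p) w)"
    and char: "w \<in> space M \<Longrightarrow> characteristic_form b T (\<lambda>t x. v t x w)"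
    and speed: "continuous_on UNIV b"
begin

definition F :: "real \<Rightarrow> real \<Rightarrow> real \<Rightarrow> real" where
  "F t x U = expectation (\<lambda>w. indicator {..U} (v t x w))"

lemma joint_measurable [measurable]:
  "(\<lambda>(p, w). v (fst p) (snd p) w) \<in> borel_measurable (borel \<Otimes>\<^sub>M M)"
  by (rule borel_measurable_Caratheodory[OF meas cont])

lemma meas' [measurable]: "v t x \<in> borel_measurable M"
  by (rule meas)

text \<open>An integral over outcomes of a jointly measurable indicator is measurable in its
  parameters. This is what licenses Fubini for \<open>F\<close> in all three variables.\<close>

lemma F_measurable [measurable]:
  "(\<lambda>q. F (fst (fst q)) (snd (fst q)) (snd q)) \<in> borel_measurable borel"
proof -
  have [measurable]: "(\<lambda>z. v (fst (fst (fst z))) (snd (fst (fst z))) (snd z))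
      \<in> borel_measurable ((borel \<Otimes>\<^sub>M (borel :: real measure)) \<Otimes>\<^sub>M M)"
    using measurable_compose[of "\<lambda>z. (fst (fst z), snd z)" "(borel \<Otimes>\<^sub>M (borel :: real measure)) \<Otimes>\<^sub>M M"
      "borel \<Otimes>\<^sub>M M", OF _ joint_measurable] by simp
  have "(\<lambda>q. F (fst (fst q)) (snd (fst q)) (snd q)) \<in> borel_measurable (borel \<Otimes>\<^sub>M borel)"
    unfolding F_def
  proof (rule borel_measurable_lebesgue_integral)
    show "(\<lambda>(q, w). indicator {..snd q} (v (fst (fst q)) (snd (fst q)) w) :: real)
       \<in> borel_measurable ((borel \<Otimes>\<^sub>M borel) \<Otimes>\<^sub>M M)"
      unfolding indicator_def case_prod_beta by simp
  qed
  then show ?thesis by (simp add: borel_prod)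
qed

lemma F_nonneg: "0 \<le> F t x U"
  unfolding F_def by (intro Bochner_Integration.integral_nonneg) auto

lemma integrable_indicator_v: "A \<in> sets borel \<Longrightarrow> integrable M (\<lambda>w. indicator A (v t x w) :: real)"
  by (rule integrable_const_bound[where B = 1]) (auto simp: indicator_def)

lemma F_le_1: "F t x U \<le> 1"
  unfolding F_def
  using integral_mono[OF integrable_indicator_v[of "{..U}"] integrable_const[of 1]]
  by (simp add: prob_space)

text \<open>For fixed \<open>U\<close> the line does not depend on the outcome, so Fubini reduces
  the integral of the tail probability over an interval to the conservation law of each single
  solution. Agreement on all intervals gives agreement almost everywhere.\<close>

lemma F_transport_AE:
  assumes "t0 \<in> {0<..<T}" "t1 \<in> {0<..<T}"
  shows "AE y in lborel. F t1 (y + b U * t1) U = F t0 (y + b U * t0) U"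
proof -
  \<comment> \<open>The tail probability \<open>1 - F\<close>, since the steps approximate
    indicators of superlevel sets.\<close>
  define G :: "real \<Rightarrow> real \<Rightarrow> real"
    where "G t y = expectation (\<lambda>w. indicator {U<..} (v t (y + b U * t) w))" for t y
  have GF: "G t y = 1 - F t (y + b U * t) U" for t y
  proof -
    have "G t y = expectation (\<lambda>w. 1 - indicator {..U} (v t (y + b U * t) w))"
      unfolding G_def by (intro Bochner_Integration.integral_cong) (auto simp: indicator_def)
    also have "\<dots> = 1 - F t (y + b U * t) U"
      unfolding F_def by (subst Bochner_Integration.integral_diff) (auto simp: prob_space intro: integrable_indicator_v)
    finally show ?thesis .
  qed
  interpret LM: pair_sigma_finite lborel M ..
  have vm [measurable]: "(\<lambda>z. v t (fst z + b U * t) (snd z)) \<in> borel_measurable (lborel \<Otimes>\<^sub>M M)" for t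
    using measurable_compose[of "\<lambda>z. ((t, fst z + b U * t), snd z)" "lborel \<Otimes>\<^sub>M M" "borel \<Otimes>\<^sub>M M",
        OF _ joint_measurable] by (simp add: borel_prod[symmetric])
  have Gm [measurable]: "G t \<in> borel_measurable borel" for t
  proof -
    have "(\<lambda>y. F (fst (fst ((t, y + b U * t), U))) (snd (fst ((t, y + b U * t), U))) (snd ((t, y + b U * t), U)))
        \<in> borel_measurable borel"
      by (rule measurable_compose[OF _ F_measurable]) (simp add: borel_prod[symmetric])
    then show ?thesis by (simp add: GF[abs_def])
  qed
  have int: "(LBINT y:{p..q}. G t y) =
      expectation (\<lambda>w. LBINT y:{p..q}. indicator {U<..} (v t (y + b U * t) w))" for p q t
  proof -
    have "integrable (lborel \<Otimes>\<^sub>M M) (\<lambda>(y, w). indicator {p..q} y * indicator {U<..} (v t (y + b U * t) w) :: real)"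
    proof (rule integrableI_bounded_set[where A = "{p..q} \<times> space M" and B = 1])
      show "(\<lambda>(y, w). indicator {p..q} y * indicator {U<..} (v t (y + b U * t) w) :: real)
          \<in> borel_measurable (lborel \<Otimes>\<^sub>M M)"
        unfolding indicator_def case_prod_beta by measurable
      show "emeasure (lborel \<Otimes>\<^sub>M M) ({p..q} \<times> space M) < \<infinity>"
        by (subst emeasure_pair_measure_Times) (auto simp: emeasure_space_1 emeasure_lborel_Icc_eq)
    qed (auto simp: indicator_def space_pair_measure)
    from LM.Fubini_integral[OF this] show ?thesis
      by (simp add: G_def set_lebesgue_integral_def)
  qed
  have "(LBINT y:{p..q}. G s1 y) = (LBINT y:{p..q}. G s0 y)"
    if "p < q" "0 < s0" "s0 < s1" "s1 < T" for p q s0 s1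
    unfolding int using that
    by (intro Bochner_Integration.integral_cong refl)
       (rule characteristic_form_superlevel_const[OF char speed])
  then have "(LBINT y:{p..q}. G t1 y) = (LBINT y:{p..q}. G t0 y)" if "p < q" for p q
    using assms that by (cases t0 t1 rule: linorder_cases) auto
  then have "AE y in lborel. G t1 y = G t0 y"
    by (intro AE_eq_of_interval_integrals Gm) (auto simp: GF F_nonneg F_le_1)
  then show ?thesis by (simp add: GF)
qed

end

section \<open>The equation in the sense of distributions\<close>

lemma frechet_derivative_eq_0_on_open:
  fixes g :: "'a::real_normed_vector \<Rightarrow> real"
  assumes "open S" "p \<in> S" "\<And>q. q \<in> S \<Longrightarrow> g q = 0"
  shows "frechet_derivative g (at p) = (\<lambda>_. 0)"
proof -
  have "((\<lambda>_. 0 :: real) has_derivative (\<lambda>_. 0)) (at p)" by simp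
  then have "(g has_derivative (\<lambda>_. 0)) (at p)"
    by (rule has_derivative_transform_within_open[OF _ assms(1,2)]) (simp add: assms(3))
  from frechet_derivative_at[OF this] show ?thesis by simp
qed

lemma has_real_derivative_along_line:
  fixes g :: "real \<times> real \<times> real \<Rightarrow> real"
  assumes g: "g differentiable (at p)" and p: "p = q + s *\<^sub>R h"
  shows "((\<lambda>r. g (q + r *\<^sub>R h)) has_real_derivative frechet_derivative g (at p) h) (at s)"
proof -
  have D: "(g has_derivative frechet_derivative g (at p)) (at (q + s *\<^sub>R h))"
    using g p frechet_derivative_works by blast
  have L: "((\<lambda>r. q + r *\<^sub>R h) has_derivative (\<lambda>r. r *\<^sub>R h)) (at s)"
    by (auto intro!: derivative_eq_intros)
  have "linear (frechet_derivative g (at p))" using D by (rule has_derivative_linear)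
  then have "frechet_derivative g (at p) (r *\<^sub>R h) = frechet_derivative g (at p) h * r" for r
    by (simp add: linear_scale)
  then show ?thesis
    using diff_chain_at[OF L D] by (simp add: has_field_derivative_def o_def)
qed

lemma has_real_derivative_coordinates:
  fixes g :: "real \<times> real \<times> real \<Rightarrow> real"
  assumes g: "g differentiable (at (t, x, U))"
  shows "((\<lambda>s. g (s, x, U)) has_real_derivative frechet_derivative g (at (t, x, U)) (1, 0, 0)) (at t)"
    and "((\<lambda>y. g (t, y, U)) has_real_derivative frechet_derivative g (at (t, x, U)) (0, 1, 0)) (at x)"
    and "((\<lambda>V. g (t, x, V)) has_real_derivative frechet_derivative g (at (t, x, U)) (0, 0, 1)) (at U)"
  using has_real_derivative_along_line[OF g, of "(0, x, U)" t "(1, 0, 0)"]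
    has_real_derivative_along_line[OF g, of "(t, 0, U)" x "(0, 1, 0)"]
    has_real_derivative_along_line[OF g, of "(t, x, 0)" U "(0, 0, 1)"] by (simp_all add: zero_prod_def)

lemma has_real_derivative_moving:
  fixes g :: "real \<times> real \<times> real \<Rightarrow> real"
  assumes g: "g differentiable (at (t, y + c * t, U))"
  shows "((\<lambda>s. g (s, y + c * s, U)) has_real_derivative
     frechet_derivative g (at (t, y + c * t, U)) (1, 0, 0) +
     c * frechet_derivative g (at (t, y + c * t, U)) (0, 1, 0)) (at t)"
proof -
  let ?D = "frechet_derivative g (at (t, y + c * t, U))"
  have lin: "linear ?D"
    using g by (meson frechet_derivative_works has_derivative_linear)
  have "?D (1, c, 0) = ?D ((1, 0, 0) + c *\<^sub>R (0, 1, 0))" by simp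
  also have "\<dots> = ?D (1, 0, 0) + c * ?D (0, 1, 0)"
    unfolding linear_add[OF lin] linear_scale[OF lin] by simp
  finally show ?thesis
    using has_real_derivative_along_line[OF g, of "(0, y, U)" t "(1, c, 0)"] by (simp add: mult.commute)
qed

lemma Ck_SucD:
  assumes "\<forall>k. Ck k g"
  shows "g differentiable (at p)" "\<forall>k. Ck k (\<lambda>p. frechet_derivative g (at p) h)"
  using assms Ck.simps(2) by blast+

lemma Ck_continuous: "\<forall>k. Ck k g \<Longrightarrow> continuous_on UNIV g"
  using Ck.simps(1) by blast

text \<open>
  In terms of \<open>\<theta> = \<partial>\<^sub>U \<psi>\<close>, the formula for \<open>\<partial>\<^sub>t \<psi>\<close> replaces the symmetry of second derivatives.
\<close>

lemma test_functionE:
  assumes "test_function T \<psi>"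
  obtains \<theta>t \<theta>x \<theta> :: "real \<times> real \<times> real \<Rightarrow> real" and R where
    "continuous_on UNIV \<theta>t" "continuous_on UNIV \<theta>x"
    "\<And>t y c U. ((\<lambda>s. \<theta> (s, y + c * s, U)) has_real_derivative
        \<theta>t (t, y + c * t, U) + c * \<theta>x (t, y + c * t, U)) (at t)"
    "\<And>t x U. \<theta> (t, x, U) \<noteq> 0 \<or> \<theta>t (t, x, U) \<noteq> 0 \<or> \<theta>x (t, x, U) \<noteq> 0 \<Longrightarrow>
        t \<in> {0<..<T} \<and> \<bar>x\<bar> \<le> R \<and> \<bar>U\<bar> \<le> R"
    "\<And>t x U. deriv (\<lambda>s. \<psi> (s, x, U)) t = - (LBINT V. indicator {U..} V * \<theta>t (t, x, V))"
    "\<And>t x U. deriv (\<lambda>y. deriv (\<lambda>V. \<psi> (t, y, V)) U) x = \<theta>x (t, x, U)"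
proof -
  have Ck: "\<forall>k. Ck k \<psi>" using assms by (simp add: test_function_def)
  define K where "K = closure {p. \<psi> p \<noteq> 0}"
  have K: "compact K" "K \<subseteq> {0<..<T} \<times> UNIV \<times> UNIV"
    using assms by (auto simp: test_function_def K_def)
  define \<theta> where "\<theta> p = frechet_derivative \<psi> (at p) (0, 0, 1)" for p
  define \<theta>t where "\<theta>t p = frechet_derivative \<theta> (at p) (1, 0, 0)" for p
  define \<theta>x where "\<theta>x p = frechet_derivative \<theta> (at p) (0, 1, 0)" for p
  have C1: "\<forall>k. Ck k \<theta>" unfolding \<theta>_def[abs_def] by (rule Ck_SucD(2)[OF Ck])
  have Ct: "\<forall>k. Ck k \<theta>t" unfolding \<theta>t_def[abs_def] by (rule Ck_SucD(2)[OF C1])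
  have Cx: "\<forall>k. Ck k \<theta>x" unfolding \<theta>x_def[abs_def] by (rule Ck_SucD(2)[OF C1])
  obtain R where R: "\<And>p. p \<in> K \<Longrightarrow> norm p \<le> R" "R > 0"
    using compact_imp_bounded[OF K(1)] unfolding bounded_pos by blast
  have op: "open (- K)" by (simp add: K_def open_Compl)
  have \<psi>0: "\<psi> p = 0" if "p \<in> - K" for p
    using that closure_subset[of "{p. \<psi> p \<noteq> 0}"] unfolding K_def by blast
  have \<theta>0: "\<theta> p = 0" if "p \<in> - K" for p
    using frechet_derivative_eq_0_on_open[OF op that \<psi>0] by (simp add: \<theta>_def)
  have \<theta>tx0: "\<theta>t p = 0 \<and> \<theta>x p = 0" if "p \<in> - K" for p
    using frechet_derivative_eq_0_on_open[OF op that \<theta>0] by (simp add: \<theta>t_def \<theta>x_def)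
  have supp: "t \<in> {0<..<T} \<and> \<bar>x\<bar> \<le> R \<and> \<bar>U\<bar> \<le> R" if "(t, x, U) \<in> K" for t x U
  proof -
    have "\<bar>x\<bar> \<le> norm (x, U)" "\<bar>U\<bar> \<le> norm (x, U)" "norm (x, U) \<le> norm (t, x, U)"
      using norm_fst_le[of x U] norm_snd_le[of U x] norm_snd_le[of "(x, U)" t] by simp_all
    then show ?thesis using R(1)[OF that] K(2) that by auto
  qed
  have \<psi>U: "((\<lambda>V. \<psi> (t, x, V)) has_real_derivative \<theta> (t, x, U)) (at U)" for t x U
    unfolding \<theta>_def by (rule has_real_derivative_coordinates(3)[OF Ck_SucD(1)[OF Ck]])
  have \<theta>t': "((\<lambda>s. \<theta> (s, x, U)) has_real_derivative \<theta>t (t, x, U)) (at t)" for t x U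
    unfolding \<theta>t_def by (rule has_real_derivative_coordinates(1)[OF Ck_SucD(1)[OF C1]])
  have \<theta>x': "((\<lambda>y. \<theta> (t, y, U)) has_real_derivative \<theta>x (t, x, U)) (at x)" for t x U
    unfolding \<theta>x_def by (rule has_real_derivative_coordinates(2)[OF Ck_SucD(1)[OF C1]])
  have \<psi>t: "deriv (\<lambda>s. \<psi> (s, x, U)) t = - (LBINT V. indicator {U..} V * \<theta>t (t, x, V))" for t x U
  proof -
    \<comment> \<open>Beyond the support in \<open>U\<close>, where \<open>\<psi>\<close> is 0, and
      never below \<open>U\<close>; the added 1 makes \<open>B\<close> strictly larger than
      \<open>R\<close>.\<close>
    define B where "B = max (R + 1) U"
    have B: "(t, x, V) \<notin> K" if "B \<le> V" "U < V \<or> R < V" for t x V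
      using supp[of t x V] that by (auto simp: B_def)
    have int: "integral (cbox U B) (\<lambda>V. \<theta> (s, x, V)) = - \<psi> (s, x, U)" for s
    proof -
      have "\<psi> (s, x, B) = 0" using supp[of s x B] by (intro \<psi>0) (auto simp: B_def)
      moreover have "((\<lambda>V. \<theta> (s, x, V)) has_integral \<psi> (s, x, B) - \<psi> (s, x, U)) {U..B}"
        by (rule fundamental_theorem_of_calculus)
          (auto simp: B_def has_real_derivative_iff_has_vector_derivative[symmetric]
            intro!: DERIV_subset[OF \<psi>U])
      ultimately show ?thesis by (simp add: has_integral_iff)
    qed
    \<comment> \<open>Since \<open>\<psi>\<close> is minus the integral of its
      \<open>U\<close>-derivative from \<open>U\<close> to \<open>B\<close>, differentiating under
      this integral expresses the time derivative of \<open>\<psi>\<close> through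
      \<open>\<theta>t\<close>, with the derivatives taken in the order \<open>U\<close>, then
      \<open>t\<close>.\<close>
    have "((\<lambda>s. integral (cbox U B) (\<lambda>V. \<theta> (s, x, V))) has_real_derivative
        integral (cbox U B) (\<lambda>V. \<theta>t (t, x, V))) (at t within UNIV)"
    proof (rule leibniz_rule_field_derivative)
      show "((\<lambda>s. \<theta> (s, x, V)) has_real_derivative \<theta>t (s, x, V)) (at s within UNIV)" for s V
        using \<theta>t' by simp
      show "(\<lambda>V. \<theta> (s, x, V)) integrable_on cbox U B" for s
        by (intro integrable_continuous continuous_on_compose2[OF Ck_continuous[OF C1]] continuous_intros) auto
      show "continuous_on (UNIV \<times> cbox U B) (\<lambda>(s, V). \<theta>t (s, x, V))"
        unfolding case_prod_beta
        by (intro continuous_on_compose2[OF Ck_continuous[OF Ct]] continuous_intros) auto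
    qed auto
    then have "((\<lambda>s. - \<psi> (s, x, U)) has_real_derivative integral {U..B} (\<lambda>V. \<theta>t (t, x, V))) (at t)"
      by (simp add: int[simplified])
    from DERIV_minus[OF this]
    have "deriv (\<lambda>s. \<psi> (s, x, U)) t = - integral {U..B} (\<lambda>V. \<theta>t (t, x, V))"
      by (intro DERIV_imp_deriv) simp
    also have "integral {U..B} (\<lambda>V. \<theta>t (t, x, V)) = (LBINT V:{U..B}. \<theta>t (t, x, V))"
      by (intro set_borel_integral_eq_integral(2)[symmetric] borel_integrable_atLeastAtMost'
          continuous_on_compose2[OF Ck_continuous[OF Ct]] continuous_intros) auto
    also have "\<dots> = (LBINT V. indicator {U..} V * \<theta>t (t, x, V))"
      unfolding set_lebesgue_integral_def
    proof (intro Bochner_Integration.integral_cong refl)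
      fix V
      have "\<theta>t (t, x, V) = 0" if "V > B"
        using supp[of t x V] that by (intro \<theta>tx0[THEN conjunct1]) (auto simp: B_def)
      then show "indicat_real {U..B} V *\<^sub>R \<theta>t (t, x, V) = indicat_real {U..} V * \<theta>t (t, x, V)"
        by (auto simp: indicator_def)
    qed
    finally show ?thesis .
  qed
  show ?thesis
  proof (rule that[of \<theta>t \<theta>x \<theta> R])
    show "((\<lambda>s. \<theta> (s, y + c * s, U)) has_real_derivative
        \<theta>t (t, y + c * t, U) + c * \<theta>x (t, y + c * t, U)) (at t)" for t y c U
      unfolding \<theta>t_def \<theta>x_def by (rule has_real_derivative_moving[OF Ck_SucD(1)[OF C1]])
    show "deriv (\<lambda>y. deriv (\<lambda>V. \<psi> (t, y, V)) U) x = \<theta>x (t, x, U)" for t x U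
      using DERIV_imp_deriv[OF \<psi>U] DERIV_imp_deriv[OF \<theta>x'] by simp
    show "t \<in> {0<..<T} \<and> \<bar>x\<bar> \<le> R \<and> \<bar>U\<bar> \<le> R"
      if "\<theta> (t, x, U) \<noteq> 0 \<or> \<theta>t (t, x, U) \<noteq> 0 \<or> \<theta>x (t, x, U) \<noteq> 0" for t x U
      using that \<theta>0[of "(t, x, U)"] \<theta>tx0[of "(t, x, U)"] supp[of t x U] by blast
  qed (use Ck_continuous[OF Ct] Ck_continuous[OF Cx] \<psi>t in auto)
qed

section \<open>Integrals of \<open>F\<close> against test functions\<close>

lemma integrable_lborel_bounded_support:
  fixes g :: "'a::euclidean_space \<Rightarrow> real"
  assumes "g \<in> borel_measurable borel" "\<And>p. \<bar>g p\<bar> \<le> C" "\<And>p. p \<notin> cbox a b \<Longrightarrow> g p = 0"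
  shows "integrable lborel g"
  by (rule integrableI_bounded_set[where A = "cbox a b" and B = C])
    (use assms emeasure_lborel_cbox_finite in auto)

lemma bounded_of_compact_support:
  fixes g :: "'a::euclidean_space \<Rightarrow> real"
  assumes "continuous_on UNIV g" "\<And>p. p \<notin> cbox a b \<Longrightarrow> g p = 0"
  obtains C where "\<And>p. \<bar>g p\<bar> \<le> C"
proof -
  have "bounded (g ` cbox a b)"
    by (intro compact_imp_bounded compact_continuous_image continuous_on_subset[OF assms(1)]) auto
  then obtain C where "\<And>p. p \<in> cbox a b \<Longrightarrow> \<bar>g p\<bar> \<le> C" "C > 0"
    unfolding bounded_pos by auto
  then have "\<bar>g p\<bar> \<le> C" for p using assms(2)[of p] by (cases "p \<in> cbox a b") auto
  then show ?thesis by (rule that)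
qed

context random_solution
begin

lemma abs_F_mult_le: "\<bar>z\<bar> \<le> C \<Longrightarrow> \<bar>F t x U * z\<bar> \<le> C"
  using mult_left_le_one_le[of "\<bar>z\<bar>" "F t x U"] F_nonneg[of t x U] F_le_1[of t x U]
  by (simp add: abs_mult)

text \<open>After the substitution \<open>x = y + b U * t\<close> the factor \<open>F\<close> no
  longer depends on \<open>t\<close>, up to null sets in \<open>y\<close>. The
  \<open>t\<close>-integral then falls on \<open>k\<close> alone, which is the derivative of
  \<open>\<theta>\<close> along the line, and \<open>\<theta>\<close> vanishes at both ends.\<close>

lemma integral_F_transport:
  assumes \<theta>: "\<And>t y. ((\<lambda>s. \<theta> (s, y + b U * s)) has_real_derivative k (t, y + b U * t)) (at t)"
    and kc: "continuous_on UNIV k"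
    and supp: "\<And>t x. \<theta> (t, x) \<noteq> 0 \<or> k (t, x) \<noteq> 0 \<Longrightarrow> t \<in> {0<..<T} \<and> \<bar>x\<bar> \<le> R"
    and "0 < T"
  shows "(LBINT t. LBINT x. F t x U * k (t, x)) = 0"
proof -
  let ?c = "b U"
  \<comment> \<open>A reference time inside the interval; \<open>H\<close> is the profile
    transported from it.\<close>
  define s where "s = T / 2"
  define H where "H y = F s (y + ?c * s) U" for y
  have sT: "s \<in> {0<..<T}" using \<open>0 < T\<close> by (simp add: s_def)
  have Hm [measurable]: "H \<in> borel_measurable borel"
  proof -
    have "(\<lambda>y. F (fst (fst ((s, y + ?c * s), U))) (snd (fst ((s, y + ?c * s), U))) (snd ((s, y + ?c * s), U)))
        \<in> borel_measurable borel"
      by (rule measurable_compose[OF _ F_measurable])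
        (auto intro!: borel_measurable_continuous_onI continuous_intros)
    then show ?thesis by (simp add: H_def[abs_def])
  qed
  have Fm: "(\<lambda>y. F t (y + ?c * t) U) \<in> borel_measurable borel" for t
  proof -
    have "(\<lambda>y. F (fst (fst ((t, y + ?c * t), U))) (snd (fst ((t, y + ?c * t), U))) (snd ((t, y + ?c * t), U)))
        \<in> borel_measurable borel"
      by (rule measurable_compose[OF _ F_measurable])
        (auto intro!: borel_measurable_continuous_onI continuous_intros)
    then show ?thesis by simp
  qed
  \<comment> \<open>The support in the moving coordinate: \<open>y = x - b U * t\<close> with
    \<open>\<bar>x\<bar> \<le> R\<close> and \<open>t\<close> between 0 and
    \<open>T\<close>.\<close>
  define R' where "R' = R + \<bar>?c\<bar> * T"
  define k' where "k' p = k (fst p, snd p + ?c * fst p)" for p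
  have k'c: "continuous_on UNIV k'"
    unfolding k'_def[abs_def] by (intro continuous_on_compose2[OF kc] continuous_intros) auto
  have k'0: "k' p = 0" if "p \<notin> cbox (0, - R') (T, R')" for p
  proof (rule ccontr)
    assume "k' p \<noteq> 0"
    then have *: "fst p \<in> {0<..<T}" "\<bar>snd p + ?c * fst p\<bar> \<le> R"
      using supp[of "fst p" "snd p + ?c * fst p"] by (simp_all add: k'_def)
    have "\<bar>?c * fst p\<bar> \<le> \<bar>?c\<bar> * T" using * by (simp add: abs_mult mult_left_mono)
    then have "\<bar>snd p\<bar> \<le> R'" using * unfolding R'_def by linarith
    then show False using that * by (cases p) (auto simp: cbox_Pair_eq)
  qed
  obtain C where C: "\<And>p. \<bar>k' p\<bar> \<le> C" using bounded_of_compact_support[OF k'c k'0] by blast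
  have km: "(\<lambda>y. k (t, y + ?c * t)) \<in> borel_measurable borel" for t
    by (intro borel_measurable_continuous_onI continuous_on_compose2[OF kc] continuous_intros) auto
  have shift: "(LBINT x. F t x U * k (t, x)) = (LBINT y. H y * k' (t, y))" for t
  proof (cases "t \<in> {0<..<T}")
    case True
    have "(LBINT x. F t x U * k (t, x)) = (LBINT y. F t (y + ?c * t) U * k (t, y + ?c * t))"
      using lborel_integral_real_affine[of 1 "\<lambda>x. F t x U * k (t, x)" "?c * t"] by (simp add: add.commute)
    also have "\<dots> = (LBINT y. H y * k' (t, y))"
    proof (rule integral_cong_AE)
      show "(\<lambda>y. F t (y + ?c * t) U * k (t, y + ?c * t)) \<in> borel_measurable lborel"
        using Fm km by simp
      show "(\<lambda>y. H y * k' (t, y)) \<in> borel_measurable lborel"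
        using Hm km by (simp add: k'_def)
      show "AE y in lborel. F t (y + ?c * t) U * k (t, y + ?c * t) = H y * k' (t, y)"
        using F_transport_AE[OF sT True, of U] by eventually_elim (simp add: H_def k'_def)
    qed
    finally show ?thesis .
  next
    case False
    then have "k (t, x) = 0" for x using supp by blast
    then show ?thesis by (simp add: k'_def)
  qed
  have int: "integrable (lborel \<Otimes>\<^sub>M lborel) (\<lambda>(t, y). H y * k' (t, y))"
    unfolding lborel_prod
  proof (rule integrable_lborel_bounded_support)
    show "(\<lambda>(t, y). H y * k' (t, y)) \<in> borel_measurable borel"
      unfolding case_prod_beta
      using measurable_compose[OF borel_measurable_snd_real Hm] borel_measurable_continuous_onI[OF k'c]
      by simp
    show "\<bar>case p of (t, y) \<Rightarrow> H y * k' (t, y)\<bar> \<le> C" for p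
      using C by (simp add: H_def case_prod_beta abs_F_mult_le)
    show "(case p of (t, y) \<Rightarrow> H y * k' (t, y)) = 0" if "p \<notin> cbox (0, - R') (T, R')" for p
      using k'0[OF that] by (auto simp: case_prod_beta)
  qed
  have "(LBINT t. LBINT x. F t x U * k (t, x)) = (LBINT t. LBINT y. H y * k' (t, y))"
    by (simp add: shift)
  also have "\<dots> = (LBINT y. LBINT t. H y * k' (t, y))"
    using lborel_pair.Fubini_integral[OF int] by simp
  also have "\<dots> = (LBINT y. H y * (LBINT t. k' (t, y)))" by simp
  also have "(\<lambda>y. LBINT t. k' (t, y)) = (\<lambda>y. 0)"
  proof
    fix y
    have "(LBINT t. k' (t, y)) = (LBINT t. indicator {0..T} t *\<^sub>R k' (t, y))"
    proof (intro Bochner_Integration.integral_cong refl)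
      fix t
      show "k' (t, y) = indicator {0..T} t *\<^sub>R k' (t, y)"
        using supp[of t "y + ?c * t"]
        by (cases "k (t, y + ?c * t) = 0") (auto simp: k'_def)
    qed
    also have "\<dots> = \<theta> (T, y + ?c * T) - \<theta> (0, y + ?c * 0)"
    proof (rule integral_FTC_Icc)
      show "((\<lambda>t. \<theta> (t, y + ?c * t)) has_vector_derivative k' (t, y)) (at t within {0..T})" for t
        using \<theta>[of y t] by (auto simp: k'_def has_real_derivative_iff_has_vector_derivative[symmetric]
            intro: DERIV_subset)
      show "continuous_on {0..T} (\<lambda>t. k' (t, y))"
        by (intro continuous_on_compose2[OF k'c] continuous_intros) auto
    qed (use \<open>0 < T\<close> in simp)
    also have "\<dots> = 0"
    proof -
      have "\<theta> (T, y + ?c * T) = 0" using supp[of T "y + ?c * T"] by force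
      moreover have "\<theta> (0, y + ?c * 0) = 0" using supp[of 0 "y + ?c * 0"] by force
      ultimately show ?thesis by simp
    qed
    finally show "(LBINT t. k' (t, y)) = 0" .
  qed
  finally show ?thesis by simp
qed

text \<open>Moving the \<open>U\<close>-derivative from \<open>F\<close> to the test function turns
  the left side into the integral of \<open>F * (\<theta>t + b U * \<theta>x)\<close>. The bracket
  is the derivative of \<open>\<theta>\<close> along the line of speed \<open>b U\<close>, so
  \<open>integral_F_transport\<close> makes the integral 0 for each single \<open>U\<close>.\<close>

lemma pdf_equation_distributional:
  assumes "0 < T"
    and fi: "\<And>t x. t \<in> {0<..<T} \<Longrightarrow> integrable lborel (f t x)"
    and fF: "\<And>t x U. t \<in> {0<..<T} \<Longrightarrow> F t x U = (LBINT z:{..U}. f t x z)"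
    and \<psi>: "test_function T \<psi>"
  shows "- (LBINT t. LBINT x. LBINT U. f t x U * deriv (\<lambda>s. \<psi> (s, x, U)) t)
        + (LBINT t. LBINT x. LBINT U.
             b U * (LBINT v:{..U}. f t x v) * deriv (\<lambda>y. deriv (\<lambda>V. \<psi> (t, y, V)) U) x)
        = 0"
proof -
  obtain \<theta>t \<theta>x \<theta> :: "real \<times> real \<times> real \<Rightarrow> real" and R where
    cont: "continuous_on UNIV \<theta>t" "continuous_on UNIV \<theta>x"
    and \<theta>': "\<And>t y c U. ((\<lambda>s. \<theta> (s, y + c * s, U)) has_real_derivative
        \<theta>t (t, y + c * t, U) + c * \<theta>x (t, y + c * t, U)) (at t)"
    and supp: "\<And>t x U. \<theta> (t, x, U) \<noteq> 0 \<or> \<theta>t (t, x, U) \<noteq> 0 \<or> \<theta>x (t, x, U) \<noteq> 0 \<Longrightarrow>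
        t \<in> {0<..<T} \<and> \<bar>x\<bar> \<le> R \<and> \<bar>U\<bar> \<le> R"
    and \<psi>t: "\<And>t x U. deriv (\<lambda>s. \<psi> (s, x, U)) t = - (LBINT V. indicator {U..} V * \<theta>t (t, x, V))"
    and \<psi>Ux: "\<And>t x U. deriv (\<lambda>y. deriv (\<lambda>V. \<psi> (t, y, V)) U) x = \<theta>x (t, x, U)"
    by (rule test_functionE[OF \<psi>]) (rule that; assumption)
  have ct [measurable]: "(\<lambda>V. \<theta>t (t, x, V)) \<in> borel_measurable borel" for t x
    by (intro borel_measurable_continuous_onI continuous_on_compose2[OF cont(1)] continuous_intros) auto
  have ti: "integrable lborel (\<lambda>V. \<theta>t (t, x, V))" for t x
  proof -
    have c: "continuous_on UNIV (\<lambda>V. \<theta>t (t, x, V))"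
      by (intro continuous_on_compose2[OF cont(1)] continuous_intros) auto
    have z: "\<theta>t (t, x, V) = 0" if "V \<notin> cbox (- R) R" for V
      using supp[of t x V] that by (cases "\<theta>t (t, x, V) = 0") auto
    obtain C where "\<And>V. \<bar>\<theta>t (t, x, V)\<bar> \<le> C" using bounded_of_compact_support[OF c z] by blast
    then show ?thesis by (intro integrable_lborel_bounded_support[OF _ _ z]) auto
  qed
  \<comment> \<open>Integration by parts in \<open>U\<close>, done by Fubini on the region
    \<open>U \<le> V\<close> because \<open>f t x\<close> is merely integrable. Outside the open
    time interval no relation between \<open>f\<close> and \<open>F\<close> is available, but the
    test function is 0 there.\<close>
  have first: "(LBINT U. f t x U * deriv (\<lambda>s. \<psi> (s, x, U)) t) = - (LBINT V. F t x V * \<theta>t (t, x, V))"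
    for t x
  proof (cases "t \<in> {0<..<T}")
    case True
    have [measurable]: "f t x \<in> borel_measurable borel"
      using borel_measurable_integrable[OF fi[OF True]] by simp
    have "integrable (lborel \<Otimes>\<^sub>M lborel) (\<lambda>(U, V). f t x U * (indicator {U..} V * \<theta>t (t, x, V)))"
    proof (rule Bochner_Integration.integrable_bound)
      show "integrable (lborel \<Otimes>\<^sub>M lborel) (\<lambda>(U, V). f t x U * \<theta>t (t, x, V))"
        by (rule lborel_pair.Fubini_integrable) (auto simp: abs_mult fi[OF True] fi[OF True, THEN integrable_abs] ti)
      have [measurable]: "(\<lambda>p :: real \<times> real. indicator {fst p..} (snd p) :: real) \<in> borel_measurable (lborel \<Otimes>\<^sub>M lborel)"
        unfolding indicator_def atLeast_iff by measurable
      show "(\<lambda>(U, V). f t x U * (indicator {U..} V * \<theta>t (t, x, V)))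
          \<in> borel_measurable (lborel \<Otimes>\<^sub>M lborel)"
        unfolding case_prod_beta by measurable
      show "AE p in lborel \<Otimes>\<^sub>M lborel. norm (case p of (U, V) \<Rightarrow> f t x U * (indicator {U..} V * \<theta>t (t, x, V)))
          \<le> norm (case p of (U, V) \<Rightarrow> f t x U * \<theta>t (t, x, V))"
        by (intro AE_I2) (auto simp: indicator_def)
    qed
    from lborel_pair.Fubini_integral[OF this]
    have "(LBINT U. LBINT V. f t x U * (indicator {U..} V * \<theta>t (t, x, V))) =
      (LBINT V. LBINT U. f t x U * (indicator {U..} V * \<theta>t (t, x, V)))" by simp
    also have "\<dots> = (LBINT V. (LBINT U. indicator {..V} U * f t x U) * \<theta>t (t, x, V))"
    proof -
      have "(\<lambda>U. f t x U * (indicator {U..} V * \<theta>t (t, x, V))) =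
          (\<lambda>U. (indicator {..V} U * f t x U) * \<theta>t (t, x, V))" for V
        by (auto simp: indicator_def)
      then show ?thesis by (simp only: integral_mult_left_zero)
    qed
    finally show ?thesis
      by (simp add: \<psi>t fF[OF True] set_lebesgue_integral_def)
  next
    case False
    then have "\<theta>t (t, x, V) = 0" for V using supp by blast
    then show ?thesis by (simp add: \<psi>t)
  qed
  have second: "(LBINT U. b U * (LBINT v:{..U}. f t x v) * deriv (\<lambda>y. deriv (\<lambda>V. \<psi> (t, y, V)) U) x)
     = (LBINT U. F t x U * (b U * \<theta>x (t, x, U)))" for t x
  proof (cases "t \<in> {0<..<T}")
    case True
    then show ?thesis by (simp add: fF \<psi>Ux mult_ac)
  next
    case False
    then have "\<theta>x (t, x, V) = 0" for V using supp by blast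
    then show ?thesis by (simp add: \<psi>Ux)
  qed
  define F' where "F' q = F (fst (fst q)) (snd (fst q)) (snd q)" for q :: "(real \<times> real) \<times> real"
  define k1 where "k1 q = \<theta>t (fst (fst q), snd (fst q), snd q)" for q :: "(real \<times> real) \<times> real"
  define k2 where "k2 q = b (snd q) * \<theta>x (fst (fst q), snd (fst q), snd q)" for q :: "(real \<times> real) \<times> real"
  have kc: "continuous_on UNIV k1" "continuous_on UNIV k2"
    unfolding k1_def[abs_def] k2_def[abs_def]
    by (intro continuous_intros continuous_on_compose2[OF cont(1)] continuous_on_compose2[OF cont(2)]
        continuous_on_compose2[OF speed]; simp)+
  have k0: "k1 q = 0 \<and> k2 q = 0" if "q \<notin> cbox ((0, - R), - R) ((T, R), R)" for q
  proof (rule ccontr)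
    assume "\<not> (k1 q = 0 \<and> k2 q = 0)"
    then have "fst (fst q) \<in> {0<..<T} \<and> \<bar>snd (fst q)\<bar> \<le> R \<and> \<bar>snd q\<bar> \<le> R"
      by (intro supp) (auto simp: k1_def k2_def)
    then show False using that by (cases q) (auto simp: cbox_Pair_eq)
  qed
  have int: "integrable (lborel \<Otimes>\<^sub>M lborel) (\<lambda>q. F' q * k q)"
    if k: "continuous_on UNIV k" "\<And>q. q \<notin> cbox ((0, - R), - R) ((T, R), R) \<Longrightarrow> k q = 0"
    for k :: "(real \<times> real) \<times> real \<Rightarrow> real"
  proof -
    obtain C where C: "\<And>p. \<bar>k p\<bar> \<le> C" using bounded_of_compact_support[OF k] by blast
    show ?thesis
      unfolding lborel_prod
    proof (rule integrable_lborel_bounded_support)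
      show "(\<lambda>q. F' q * k q) \<in> borel_measurable borel"
        unfolding F'_def
        by (rule borel_measurable_times[OF F_measurable borel_measurable_continuous_onI[OF k(1)]])
      show "\<bar>F' q * k q\<bar> \<le> C" for q
        using C by (simp add: F'_def abs_F_mult_le)
    qed (use k(2) in auto)
  qed
  note int12 = int[OF kc(1) k0[THEN conjunct1]] int[OF kc(2) k0[THEN conjunct2]]
  have iter: "(LBINT t. LBINT x. LBINT U. F t x U * k ((t, x), U)) =
      integral\<^sup>L (lborel \<Otimes>\<^sub>M lborel) (\<lambda>q. F' q * k q)"
    if "integrable (lborel \<Otimes>\<^sub>M lborel) (\<lambda>q. F' q * k q)" for k
  proof -
    have "integrable lborel (\<lambda>p. LBINT U. F' (p, U) * k (p, U))"
      using lborel_pair.integrable_fst'[OF that] by simp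
    then have "integrable (lborel \<Otimes>\<^sub>M lborel) (\<lambda>p. LBINT U. F' (p, U) * k (p, U))"
      by (simp add: lborel_prod)
    from lborel_pair.integral_fst'[OF this] show ?thesis
      using lborel_pair.integral_fst'[OF that] by (simp add: lborel_prod F'_def)
  qed
  have "- (LBINT t. LBINT x. LBINT U. f t x U * deriv (\<lambda>s. \<psi> (s, x, U)) t)
        + (LBINT t. LBINT x. LBINT U.
             b U * (LBINT v:{..U}. f t x v) * deriv (\<lambda>y. deriv (\<lambda>V. \<psi> (t, y, V)) U) x)
     = (LBINT t. LBINT x. LBINT U. F t x U * k1 ((t, x), U)) +
       (LBINT t. LBINT x. LBINT U. F t x U * k2 ((t, x), U))"
    by (simp add: first second k1_def k2_def)
  also have "\<dots> = integral\<^sup>L (lborel \<Otimes>\<^sub>M lborel) (\<lambda>q. F' q * (k1 q + k2 q))"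
    using iter[OF int12(1)] iter[OF int12(2)] Bochner_Integration.integral_add[OF int12]
    by (simp add: distrib_left)
  \<comment> \<open>The order is reversed to put \<open>U\<close> outermost: the speed of the lines
    depends on \<open>U\<close>, which has to be fixed before the transport is applied.\<close>
  also have "\<dots> = (LBINT U. LBINT p. F' (p, U) * (k1 (p, U) + k2 (p, U)))"
  proof -
    have "integrable (lborel \<Otimes>\<^sub>M lborel) (\<lambda>q. F' q * (k1 q + k2 q))"
      by (intro int continuous_on_add kc) (simp add: k0)
    then have "integrable (lborel \<Otimes>\<^sub>M lborel) (\<lambda>(p, U). F' (p, U) * (k1 (p, U) + k2 (p, U)))"
      by (simp add: case_prod_unfold)
    from lborel_pair.integral_snd[OF this] show ?thesis by (simp add: case_prod_unfold)
  qed
  also have "\<dots> = integral\<^sup>L lborel (\<lambda>U :: real. 0)"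
  proof (intro Bochner_Integration.integral_cong refl)
    fix U
    define k where "k p = k1 (p, U) + k2 (p, U)" for p
    have kU: "continuous_on UNIV k"
      unfolding k_def[abs_def]
      by (intro continuous_intros continuous_on_compose2[OF kc(1)] continuous_on_compose2[OF kc(2)]) auto
    have kz: "k p = 0" if "p \<notin> cbox (0, - R) (T, R)" for p
      using that k0[of "(p, U)"] by (auto simp: k_def cbox_Pair_eq)
    obtain C where C: "\<And>p. \<bar>k p\<bar> \<le> C" using bounded_of_compact_support[OF kU kz] by blast
    have "integrable (lborel \<Otimes>\<^sub>M lborel) (\<lambda>p. F' (p, U) * k p)"
      unfolding lborel_prod
    proof (rule integrable_lborel_bounded_support)
      have F'm: "(\<lambda>p. F' (p, U)) \<in> borel_measurable borel"
        unfolding F'_def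
        by (rule measurable_compose[OF _ F_measurable, of "\<lambda>p. (p, U)"])
          (auto intro!: borel_measurable_continuous_onI continuous_intros)
      show "(\<lambda>p. F' (p, U) * k p) \<in> borel_measurable borel"
        by (rule borel_measurable_times[OF F'm borel_measurable_continuous_onI[OF kU]])
      show "\<bar>F' (p, U) * k p\<bar> \<le> C" for p
        using C by (simp add: F'_def abs_F_mult_le)
    qed (use kz in auto)
    from lborel_pair.integral_fst'[OF this]
    have "(LBINT p. F' (p, U) * k p) = (LBINT t. LBINT x. F t x U * k (t, x))"
      by (simp add: lborel_prod F'_def)
    also have "\<dots> = 0"
    proof (rule integral_F_transport[where \<theta> = "\<lambda>p. \<theta> (fst p, snd p, U)" and R = R, OF _ kU _ \<open>0 < T\<close>])
      show "((\<lambda>s. \<theta> (fst (s, y + b U * s), snd (s, y + b U * s), U)) has_real_derivative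
          k (t, y + b U * t)) (at t)" for t y
        using \<theta>'[of y "b U" U t] by (simp add: k_def k1_def k2_def)
      show "t \<in> {0<..<T} \<and> \<bar>x\<bar> \<le> R"
        if "\<theta> (fst (t, x), snd (t, x), U) \<noteq> 0 \<or> k (t, x) \<noteq> 0" for t x
      proof -
        have "\<theta> (t, x, U) \<noteq> 0 \<or> \<theta>t (t, x, U) \<noteq> 0 \<or> \<theta>x (t, x, U) \<noteq> 0"
          using that by (auto simp: k_def k1_def k2_def)
        from supp[OF this] show ?thesis by simp
      qed
    qed
    finally show "(LBINT p. F' (p, U) * (k1 (p, U) + k2 (p, U))) = 0" by (simp add: k_def)
  qed
  finally show ?thesis by simp
qed

end

section \<open>The equation for regular densities\<close>

text \<open>The mean value inequality bounds the difference quotients by \<open>g\<close>, so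
  dominated convergence applies along every null sequence of increments. Measurability of
  \<open>h' s0\<close> comes from the same quotients, of which it is a limit.\<close>

lemma has_real_derivative_integral_dominated:
  fixes h h' :: "real \<Rightarrow> 'v \<Rightarrow> real"
  assumes e: "0 < e"
    and int: "\<And>s. \<bar>s - s0\<bar> < e \<Longrightarrow> integrable M (h s)"
    and D: "\<And>s v. \<bar>s - s0\<bar> < e \<Longrightarrow> ((\<lambda>s. h s v) has_real_derivative h' s v) (at s)"
    and g: "integrable M g" "\<And>s v. \<bar>s - s0\<bar> < e \<Longrightarrow> \<bar>h' s v\<bar> \<le> g v"
  shows "integrable M (h' s0)"
    and "((\<lambda>s. \<integral>v. h s v \<partial>M) has_real_derivative (\<integral>v. h' s0 v \<partial>M)) (at s0)"
proof -
  have quot: "integrable M (h' s0) \<and>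
      (\<lambda>n. ((\<integral>v. h (s0 + X n) v \<partial>M) - (\<integral>v. h s0 v \<partial>M)) / X n) \<longlonglongrightarrow> (\<integral>v. h' s0 v \<partial>M)"
    if X: "\<And>n. X n \<noteq> 0" "\<And>n. \<bar>X n\<bar> < e" "X \<longlonglongrightarrow> 0" for X :: "nat \<Rightarrow> real"
  proof -
    define q where "q n v = (h (s0 + X n) v - h s0 v) / X n" for n v
    have iX: "integrable M (h (s0 + X n))" for n using int[of "s0 + X n"] X(2)[of n] by simp
    have i0: "integrable M (h s0)" using int[of s0] e by simp
    have iq: "integrable M (q n)" for n
      unfolding q_def[abs_def] by (intro integrable_divide Bochner_Integration.integrable_diff iX i0)
    have lim: "(\<lambda>n. q n v) \<longlonglongrightarrow> h' s0 v" for v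
    proof -
      have "((\<lambda>d. (h (s0 + d) v - h s0 v) / d) \<longlongrightarrow> h' s0 v) (at 0)"
        using D[of s0 v] e by (simp add: DERIV_def)
      then show ?thesis
        unfolding q_def by (rule filterlim_compose) (use X in \<open>simp add: filterlim_at\<close>)
    qed
    have bound: "\<bar>q n v\<bar> \<le> g v" for n v
    proof -
      have "norm (h (s0 + X n) v - h s0 v) \<le> g v * norm (s0 + X n - s0)"
      proof (rule field_differentiable_bound[where S = "ball s0 e" and f' = "\<lambda>s. h' s v"])
        fix s assume "s \<in> ball s0 e"
        then have s: "\<bar>s - s0\<bar> < e" by (simp add: dist_real_def abs_minus_commute)
        show "((\<lambda>s. h s v) has_real_derivative h' s v) (at s within ball s0 e)"
          by (rule DERIV_subset[OF D[OF s]]) simp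
        show "norm (h' s v) \<le> g v" using g(2)[OF s] by simp
      qed (use e X(2)[of n] in \<open>auto simp: dist_real_def\<close>)
      then show ?thesis using X(1)[of n] by (simp add: q_def field_simps)
    qed
    have m: "h' s0 \<in> borel_measurable M"
      by (rule borel_measurable_LIMSEQ_real[OF lim]) (use iq in auto)
    have "integrable M (h' s0)"
      by (rule integrable_dominated_convergence[OF m _ g(1), of q]) (use iq lim bound in auto)
    moreover have "(\<lambda>n. \<integral>v. q n v \<partial>M) \<longlonglongrightarrow> (\<integral>v. h' s0 v \<partial>M)"
      by (rule integral_dominated_convergence[OF m _ g(1)]) (use iq lim bound in auto)
    moreover have "(\<integral>v. q n v \<partial>M) = ((\<integral>v. h (s0 + X n) v \<partial>M) - (\<integral>v. h s0 v \<partial>M)) / X n" for n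
      unfolding q_def by (simp add: Bochner_Integration.integral_diff[OF iX i0])
    ultimately show ?thesis by simp
  qed
  \<comment> \<open>A concrete null sequence, used only for integrability of \<open>h' s0\<close>;
    it starts at \<open>e / 2\<close> because increments must be strictly smaller than
    \<open>e\<close>.\<close>
  have "(\<lambda>n. e / real (Suc (Suc n))) \<longlonglongrightarrow> 0"
    using lim_const_over_n[of e, THEN LIMSEQ_Suc, THEN LIMSEQ_Suc] .
  moreover have "\<bar>e / real (Suc (Suc n))\<bar> < e" for n
    using e by (simp add: field_simps add_pos_nonneg)
  ultimately show "integrable M (h' s0)"
    using quot[of "\<lambda>n. e / real (Suc (Suc n))"] e by simp
  show "((\<lambda>s. \<integral>v. h s v \<partial>M) has_real_derivative (\<integral>v. h' s0 v \<partial>M)) (at s0)"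
    unfolding DERIV_def tendsto_at_iff_sequentially
  proof (intro allI impI)
    fix X :: "nat \<Rightarrow> real" assume X: "\<forall>i. X i \<in> UNIV - {0}" "X \<longlonglongrightarrow> 0"
    have "eventually (\<lambda>n. \<bar>X n\<bar> < e) sequentially"
      using tendstoD[OF X(2) e] by (simp add: dist_real_def)
    then obtain N where N: "\<And>n. n \<ge> N \<Longrightarrow> \<bar>X n\<bar> < e" by (auto simp: eventually_sequentially)
    have "(\<lambda>n. ((\<integral>v. h (s0 + X (n + N)) v \<partial>M) - (\<integral>v. h s0 v \<partial>M)) / X (n + N)) \<longlonglongrightarrow> (\<integral>v. h' s0 v \<partial>M)"
      using quot[of "\<lambda>n. X (n + N)"] X N LIMSEQ_ignore_initial_segment[OF X(2), of N] by auto
    from LIMSEQ_offset[OF this]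
    show "((\<lambda>d. ((\<integral>v. h (s0 + d) v \<partial>M) - (\<integral>v. h s0 v \<partial>M)) / d) \<circ> X) \<longlonglongrightarrow> (\<integral>v. h' s0 v \<partial>M)"
      by (simp add: o_def)
  qed
qed

text \<open>The set of disagreement is open, and a nonempty open set is not a null set.\<close>

lemma AE_lborel_eq_continuous:
  fixes g h :: "real \<Rightarrow> real"
  assumes "continuous_on UNIV g" "continuous_on UNIV h" and ae: "AE y in lborel. g y = h y"
  shows "g y = h y"
proof (rule ccontr)
  assume "g y \<noteq> h y"
  then have ne: "{y. g y \<noteq> h y} \<noteq> {}" by auto
  have op: "open {y. g y \<noteq> h y}" using assms(1,2) by (rule open_Collect_neq)
  then have "{y. g y \<noteq> h y} \<in> null_sets lborel"
    using ae by (subst AE_iff_null_sets) (auto simp: borel_open)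
  then have "negligible {y. g y \<noteq> h y}"
    by (simp add: negligible_iff_null_sets null_sets_completionI)
  with open_not_negligible[OF op ne] show False by simp
qed

lemma has_real_derivative_integral_atMost:
  fixes g :: "real \<Rightarrow> real"
  assumes c: "continuous_on UNIV g" and int: "\<And>V. set_integrable lborel {..V} g"
  shows "((\<lambda>V. LBINT v:{..V}. g v) has_real_derivative g U) (at U)"
proof -
  have "((\<lambda>V. integral {U - 1..V} g) has_real_derivative g U) (at U within {U - 1..U + 1})"
    by (intro integral_has_real_derivative continuous_on_subset[OF c]) auto
  \<comment> \<open>Splitting off the constant integral up to \<open>U - 1\<close> leaves a bounded
    interval with \<open>U\<close> in its interior.\<close>
  then have "((\<lambda>V. (LBINT v:{..U - 1}. g v) + integral {U - 1..V} g) has_real_derivative g U) (at U)"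
    by (subst (asm) at_within_interior) (auto intro!: derivative_eq_intros)
  then show ?thesis
  proof (rule has_field_derivative_transform_within_open[of _ _ _ "{U - 1<..}"])
    fix V assume V: "V \<in> {U - 1<..}"
    have i: "set_integrable lborel {U - 1..V} g"
      by (intro borel_integrable_atLeastAtMost' continuous_on_subset[OF c]) auto
    have "(LBINT v:{..U - 1} \<union> {U - 1..V}. g v) = (LBINT v:{..U - 1}. g v) + (LBINT v:{U - 1..V}. g v)"
    proof (rule set_integral_Un_AE)
      show "AE v in lborel. \<not> (v \<in> {..U - 1} \<and> v \<in> {U - 1..V})"
        using AE_lborel_singleton[of "U - 1"] by eventually_elim auto
    qed (use int i in auto)
    moreover have "{..U - 1} \<union> {U - 1..V} = {..V}" using V by auto
    ultimately show "(LBINT v:{..U - 1}. g v) + integral {U - 1..V} g = (LBINT v:{..V}. g v)"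
      by (simp add: set_borel_integral_eq_integral(2)[OF i])
  qed auto
qed

context random_solution
begin

lemma F_eq_integral_density:
  assumes p: "is_pdf (distr M borel (v t x)) p"
  shows "integrable lborel p" and "F t x U = (LBINT z:{..U}. p z)"
proof -
  have [measurable]: "p \<in> borel_measurable borel" and nn: "\<And>z. 0 \<le> p z"
    and eq: "distr M borel (v t x) = density lborel (\<lambda>z. ennreal (p z))"
    using p by (auto simp: is_pdf_def)
  interpret D: prob_space "distr M borel (v t x)" by (rule prob_space_distr) (rule meas)
  have "(\<integral>\<^sup>+z. ennreal (p z) \<partial>lborel) = emeasure (density lborel (\<lambda>z. ennreal (p z))) UNIV"
    by (simp add: emeasure_density)
  also have "\<dots> = 1" using D.emeasure_space_1 unfolding eq by simp
  finally show "integrable lborel p"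
    by (intro integrableI_nonneg) (auto simp: nn)
  have "F t x U = integral\<^sup>L (distr M borel (v t x)) (indicator {..U})"
    unfolding F_def by (subst integral_distr) auto
  also have "\<dots> = (LBINT z. p z * indicator {..U} z)"
    unfolding eq by (subst integral_real_density) (auto simp: nn)
  finally show "F t x U = (LBINT z:{..U}. p z)"
    by (simp add: set_lebesgue_integral_def mult.commute)
qed

lemma F_along_characteristic:
  assumes cont: "\<And>s. s \<in> {0<..<T} \<Longrightarrow> continuous_on UNIV (\<lambda>y. F s y U)"
    and "s \<in> {0<..<T}" "t \<in> {0<..<T}"
  shows "F s x U = F t (x + b U * (t - s)) U"
proof -
  have "F s (y + b U * s) U = F t (y + b U * t) U" for y
  proof (rule AE_lborel_eq_continuous[where g = "\<lambda>y. F s (y + b U * s) U" and h = "\<lambda>y. F t (y + b U * t) U"])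
    show "AE y in lborel. F s (y + b U * s) U = F t (y + b U * t) U"
      using assms by (intro F_transport_AE)
    show "continuous_on UNIV (\<lambda>y. F s (y + b U * s) U)" "continuous_on UNIV (\<lambda>y. F t (y + b U * t) U)"
      using assms by (auto intro!: continuous_on_compose2[OF cont] continuous_intros)
  qed
  from this[of "x - b U * s"] show ?thesis by (simp add: algebra_simps)
qed

text \<open>Differentiating \<open>F s x V = F t (x + b V * (t - s)) V\<close> in \<open>s\<close>
  at \<open>s = t\<close> gives the transport equation for \<open>F\<close>; domination identifies
  its derivatives with integrals of \<open>ft\<close> and \<open>fx\<close>. Differentiation in
  \<open>V\<close> then yields the equation for \<open>f\<close>.\<close>

lemma pdf_equation_pointwise:
  assumes b: "b = deriv a"
    and reg: "regular_density T f"
    and fi: "\<And>t x. t \<in> {0<..<T} \<Longrightarrow> integrable lborel (f t x)"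
    and fF: "\<And>t x U. t \<in> {0<..<T} \<Longrightarrow> F t x U = (LBINT z:{..U}. f t x z)"
  shows "solves_pdf_equation_pointwise a T f"
proof -
  define ft where "ft t x v = deriv (\<lambda>s. f s x v) t" for t x v
  define fx where "fx t x v = deriv (\<lambda>y. f t y v) x" for t x v
  have Dt: "((\<lambda>s. f s x v) has_real_derivative ft t x v) (at t)"
    and Dx: "((\<lambda>y. f t y v) has_real_derivative fx t x v) (at x)"
    and ftc: "continuous_on UNIV (ft t x)" if "t \<in> {0<..<T}" for t x v
    using reg that unfolding regular_density_def ft_def fx_def
    by (simp_all add: DERIV_deriv_iff_real_differentiable)
  have dom: "set_integrable lborel {..V} (ft t x) \<and> set_integrable lborel {..V} (fx t x) \<and>
      ((\<lambda>s. F s x V) has_real_derivative (LBINT v:{..V}. ft t x v)) (at t) \<and>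
      ((\<lambda>y. F t y V) has_real_derivative (LBINT v:{..V}. fx t x v)) (at x)"
    if t: "t \<in> {0<..<T}" for t x V
  proof -
    obtain \<delta> g where \<delta>: "\<delta> > 0" and g: "integrable lborel g"
      and le: "\<And>s y v. s \<in> {0<..<T} \<Longrightarrow> \<bar>s - t\<bar> < \<delta> \<Longrightarrow> \<bar>y - x\<bar> < \<delta> \<Longrightarrow>
          \<bar>ft s y v\<bar> \<le> g v \<and> \<bar>fx s y v\<bar> \<le> g v"
      using reg t unfolding regular_density_def ft_def fx_def by meson
    have gn: "0 \<le> g v" for v using le[of t x v] t \<delta> by force
    \<comment> \<open>The window in time must also stay inside the open interval, where the
      derivatives exist and the bound holds.\<close>
    define e where "e = min \<delta> (min t (T - t))"
    have near: "s \<in> {0<..<T} \<and> \<bar>s - t\<bar> < \<delta>" if "\<bar>s - t\<bar> < e" for s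
      using that t \<delta> by (auto simp: e_def)
    have e: "e > 0" using t \<delta> by (auto simp: e_def)
    have si: "integrable lborel (\<lambda>v. indicator {..V} v * f s y v)" if "s \<in> {0<..<T}" for s y
      using integrable_mult_indicator[OF _ fi[OF that], of "{..V}" y] by simp
    have it: "integrable lborel (\<lambda>v. indicator {..V} v * ft t x v)"
      and dt: "((\<lambda>s. LBINT v. indicator {..V} v * f s x v) has_real_derivative
          (LBINT v. indicator {..V} v * ft t x v)) (at t)"
    proof -
      have "\<bar>indicator {..V} v * ft s x v\<bar> \<le> g v" if "\<bar>s - t\<bar> < e" for s v
        using le[of s x v] near[OF that] \<delta> gn[of v] by (auto simp: indicator_def)
      moreover have "((\<lambda>s. indicator {..V} v * f s x v) has_real_derivative indicator {..V} v * ft s x v) (at s)"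
        if "\<bar>s - t\<bar> < e" for s v
        using near[OF that] by (intro DERIV_cmult Dt) simp
      ultimately show "integrable lborel (\<lambda>v. indicator {..V} v * ft t x v)"
        "((\<lambda>s. LBINT v. indicator {..V} v * f s x v) has_real_derivative
          (LBINT v. indicator {..V} v * ft t x v)) (at t)"
        using has_real_derivative_integral_dominated[of e t lborel "\<lambda>s v. indicator {..V} v * f s x v"
          "\<lambda>s v. indicator {..V} v * ft s x v" g] e si near g by auto
    qed
    have ix: "integrable lborel (\<lambda>v. indicator {..V} v * fx t x v)"
      and dx: "((\<lambda>y. LBINT v. indicator {..V} v * f t y v) has_real_derivative
          (LBINT v. indicator {..V} v * fx t x v)) (at x)"
    proof -
      have "\<bar>indicator {..V} v * fx t y v\<bar> \<le> g v" if "\<bar>y - x\<bar> < \<delta>" for y v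
        using le[of t y v] t that \<delta> gn[of v] by (auto simp: indicator_def)
      moreover have "((\<lambda>y. indicator {..V} v * f t y v) has_real_derivative indicator {..V} v * fx t y v) (at y)"
        for y v
        using t by (intro DERIV_cmult Dx)
      ultimately show "integrable lborel (\<lambda>v. indicator {..V} v * fx t x v)"
        "((\<lambda>y. LBINT v. indicator {..V} v * f t y v) has_real_derivative
          (LBINT v. indicator {..V} v * fx t x v)) (at x)"
        using has_real_derivative_integral_dominated[of \<delta> x lborel "\<lambda>y v. indicator {..V} v * f t y v"
          "\<lambda>y v. indicator {..V} v * fx t y v" g] \<delta> si[OF t] g by auto
    qed
    have Ft: "F s y V = (LBINT v. indicator {..V} v * f s y v)" if "s \<in> {0<..<T}" for s y
      using fF[OF that] by (simp add: set_lebesgue_integral_def)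
    have "((\<lambda>s. F s x V) has_real_derivative (LBINT v. indicator {..V} v * ft t x v)) (at t)"
      by (rule has_field_derivative_transform_within_open[OF dt, of "{0<..<T}"]) (use t Ft in auto)
    moreover have "((\<lambda>y. F t y V) has_real_derivative (LBINT v. indicator {..V} v * fx t x v)) (at x)"
      using dx t by (simp add: Ft)
    ultimately show ?thesis
      using it ix by (simp add: set_integrable_def set_lebesgue_integral_def)
  qed
  have cont: "continuous_on UNIV (\<lambda>y. F t y V)" if "t \<in> {0<..<T}" for t V
    using dom[OF that] by (meson DERIV_isCont continuous_at_imp_continuous_on)
  have flux: "b V * (LBINT v:{..V}. fx t x v) = - (LBINT v:{..V}. ft t x v)"
    if t: "t \<in> {0<..<T}" for t x V
  proof -
    have "((\<lambda>y. F t y V) has_real_derivative (LBINT v:{..V}. fx t x v)) (at (x + b V * (t - t)))"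
      using dom[OF t] by simp
    \<comment> \<open>Time is frozen at \<open>t\<close> in \<open>F\<close> and \<open>s\<close>
      enters only through the position, so the chain rule in one variable suffices.\<close>
    then have "((\<lambda>s. F t (x + b V * (t - s)) V) has_real_derivative (LBINT v:{..V}. fx t x v) * (- b V)) (at t)"
      by (rule DERIV_chain2) (auto intro!: derivative_eq_intros)
    then have "((\<lambda>s. F s x V) has_real_derivative (LBINT v:{..V}. fx t x v) * (- b V)) (at t)"
      by (rule has_field_derivative_transform_within_open[of _ _ _ "{0<..<T}"])
        (use t F_along_characteristic[OF cont, symmetric] in auto)
    with dom[OF t, of V x] have "(LBINT v:{..V}. ft t x v) = (LBINT v:{..V}. fx t x v) * (- b V)"
      by (meson DERIV_unique)
    then show ?thesis by simp
  qed
  \<comment> \<open>The product rule would require a derivative of \<open>deriv a\<close>. Instead,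
    the product is rewritten as minus the integral of \<open>ft\<close>, which is differentiable in
    \<open>V\<close> because \<open>ft\<close> is continuous in that variable.\<close>
  have Dflux: "((\<lambda>V. deriv a V * (LBINT v:{..V}. fx t x v)) has_real_derivative - ft t x U) (at U)"
    if t: "t \<in> {0<..<T}" for t x U
    unfolding b[symmetric] flux[OF t]
    using dom[OF t] by (intro DERIV_minus has_real_derivative_integral_atMost ftc[OF t]) auto
  show ?thesis
    unfolding solves_pdf_equation_pointwise_def ft_def[symmetric] fx_def[symmetric]
  proof (intro ballI allI conjI)
    fix t x U assume t: "t \<in> {0<..<T}"
    show "(\<lambda>s. f s x U) differentiable (at t)"
      using Dt[OF t] real_differentiable_def by blast
    show "set_integrable lborel {..U} (fx t x)" using dom[OF t] by blast
    show "(\<lambda>V. deriv a V * (LBINT v:{..V}. fx t x v)) differentiable (at U)"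
      using Dflux[OF t] real_differentiable_def by blast
    show "ft t x U + deriv (\<lambda>V. deriv a V * (LBINT v:{..V}. fx t x v)) U = 0"
      using DERIV_imp_deriv[OF Dflux[OF t]] by simp
  qed
qed

end

section \<open>From almost surely strong solutions to a random solution\<close>

lemma strong_solution_imp_characteristic_form:
  assumes v: "strong_solution a T v0 v" and a: "\<And>U. a differentiable (at U)"
  shows "characteristic_form (deriv a) T v"
  unfolding characteristic_form_def
proof (intro ballI allI)
  fix t x assume t: "t \<in> {0<..<T}"
  let ?v = "\<lambda>(s, y). v s y"
  obtain D where D: "(?v has_derivative D) (at (t, x))"
    and eq: "deriv (\<lambda>s. v s x) t + deriv (\<lambda>y. a (v t y)) x = 0"
    using v t unfolding strong_solution_def differentiable_def by blast
  have lin: "linear D" using D by (rule has_derivative_linear)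
  have "((\<lambda>s. (s, x)) has_derivative (\<lambda>h. (h, 0))) (at t)"
    "((\<lambda>y. (t, y)) has_derivative (\<lambda>h. (0, h))) (at x)"
    by (auto intro!: derivative_eq_intros)
  from diff_chain_at[OF this(1) D] diff_chain_at[OF this(2) D]
  have 1: "((\<lambda>s. v s x) has_derivative (\<lambda>h. D (h, 0))) (at t)"
    and 2: "((\<lambda>y. v t y) has_derivative (\<lambda>h. D (0, h))) (at x)"
    by (simp_all add: o_def)
  have e1: "(\<lambda>h. D (h, 0)) = (*) (D (1, 0))"
  proof
    show "D (h, 0) = D (1, 0) * h" for h
      using linear_scale[OF lin, of h "(1, 0)"] by (simp add: mult.commute)
  qed
  have e2: "(\<lambda>h. D (0, h)) = (*) (D (0, 1))"
  proof
    show "D (0, h) = D (0, 1) * h" for h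
      using linear_scale[OF lin, of h "(0, 1)"] by (simp add: mult.commute)
  qed
  have 1: "((\<lambda>s. v s x) has_real_derivative D (1, 0)) (at t)"
    using 1 unfolding e1 has_field_derivative_def .
  have 2: "((\<lambda>y. v t y) has_real_derivative D (0, 1)) (at x)"
    using 2 unfolding e2 has_field_derivative_def .
  have "(a has_real_derivative deriv a (v t x)) (at (v t x))"
    using a by (simp add: DERIV_deriv_iff_real_differentiable)
  from DERIV_chain2[OF this 2] 1 eq have "D (1, 0) + deriv a (v t x) * D (0, 1) = 0"
    by (simp add: DERIV_imp_deriv)
  with D show "\<exists>D. (?v has_derivative D) (at (t, x)) \<and> D (1, 0) + deriv a (v t x) * D (0, 1) = 0"
    by blast
qed

text \<open>Strong solutions are given almost surely and on \<open>[0, T]\<close>, while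
  \<open>random_solution\<close> asks for every outcome and continuity on the whole plane. Neither
  change affects the laws at times in the open interval.\<close>

lemma no_shocks_random_solution:
  assumes M: "prob_space M"
    and a: "\<And>U. a differentiable (at U)" "strictly_convex a"
    and meas: "\<And>t x. 0 \<le> t \<Longrightarrow> u t x \<in> borel_measurable M"
    and "0 < T" and ns: "no_shocks_almost_surely a T M u0 u"
  obtains v where "random_solution M (deriv a) T v"
    and "\<And>t x. t \<in> {0<..<T} \<Longrightarrow> distr M borel (v t x) = distr M borel (u t x)"
proof -
  obtain N where N: "N \<in> null_sets M"
    "\<And>w. w \<in> space M - N \<Longrightarrow> strong_solution a T (\<lambda>x. u0 x w) (\<lambda>t x. u t x w)"
    using ns unfolding no_shocks_almost_surely_def by (elim AE_E3) blast
  have Ns: "N \<in> sets M" using N(1) by auto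
  \<comment> \<open>Clamping time to \<open>[0, T]\<close> extends the solution continuously to all
    times and is the identity on the open interval.\<close>
  define \<tau> where "\<tau> t = max 0 (min T t)" for t
  have \<tau>: "\<tau> t \<in> {0..T}" "t \<in> {0<..<T} \<Longrightarrow> \<tau> t = t" for t
    using \<open>0 < T\<close> by (auto simp: \<tau>_def)
  \<comment> \<open>On the exceptional set the value 0 is used: a constant is continuous and solves
    the equation.\<close>
  define v where "v t x w = (if w \<in> N then 0 else u (\<tau> t) x w)" for t x w
  have vm: "v t x \<in> borel_measurable M" for t x
    unfolding v_def[abs_def] using meas[of "\<tau> t" x] \<tau>(1)[of t] Ns
    by (intro measurable_If_set) auto
  show ?thesis
  proof (rule that[of v])
    show "random_solution M (deriv a) T v"
      unfolding random_solution_def random_solution_axioms_def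
    proof (intro conjI allI impI)
      show "prob_space M" by (rule M)
      show "v t x \<in> borel_measurable M" for t x by (rule vm)
      show "continuous_on UNIV (deriv a)"
        using isCont_deriv_strictly_convex[OF a(2,1)] by (simp add: continuous_at_imp_continuous_on)
      show "continuous_on UNIV (\<lambda>p. v (fst p) (snd p) w)" if w: "w \<in> space M" for w
      proof (cases "w \<in> N")
        case False
        then have "continuous_on ({0..T} \<times> UNIV) (\<lambda>(t, x). u t x w)"
          using N(2) w by (simp add: strong_solution_def)
        then have "continuous_on UNIV (\<lambda>p. (\<lambda>(t, x). u t x w) (\<tau> (fst p), snd p))"
          by (rule continuous_on_compose2)
            (use \<tau>(1) in \<open>auto simp: \<tau>_def intro!: continuous_intros\<close>)
        then show ?thesis using False by (simp add: v_def)
      qed (simp add: v_def)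
      show "characteristic_form (deriv a) T (\<lambda>t x. v t x w)" if w: "w \<in> space M" for w
      proof (cases "w \<in> N")
        case True
        then show ?thesis
          by (auto simp: v_def characteristic_form_def case_prod_unfold intro!: exI[of _ "\<lambda>_. 0"])
      next
        case False
        have c: "characteristic_form (deriv a) T (\<lambda>t x. u t x w)"
          by (rule strong_solution_imp_characteristic_form[OF N(2) a(1)]) (use w False in auto)
        show ?thesis
          unfolding characteristic_form_def
        proof (intro ballI allI)
          fix t x assume t: "t \<in> {0<..<T}"
          obtain D where D: "((\<lambda>(s, y). u s y w) has_derivative D) (at (t, x))"
            "D (1, 0) + deriv a (u t x w) * D (0, 1) = 0"
            using c t unfolding characteristic_form_def by blast
          have "((\<lambda>(s, y). v s y w) has_derivative D) (at (t, x))"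
            by (rule has_derivative_transform_within_open[OF D(1), of "{0<..<T} \<times> UNIV"])
              (use t False \<tau>(2) in \<open>auto simp: v_def open_Times\<close>)
          then show "\<exists>D. ((\<lambda>(s, y). v s y w) has_derivative D) (at (t, x)) \<and>
              D (1, 0) + deriv a (v t x w) * D (0, 1) = 0"
            using D(2) False \<tau>(2)[OF t] by (auto simp: v_def)
        qed
      qed
    qed
    show "distr M borel (v t x) = distr M borel (u t x)" if t: "t \<in> {0<..<T}" for t x
    proof (rule distr_cong_AE)
      show "AE w in M. v t x w = u t x w"
        using AE_not_in[OF N(1)] by eventually_elim (simp add: v_def \<tau>(2)[OF t])
    qed (use vm meas[of t x] t in auto)
  qed
qed

theorem theorem3p2:
  fixes \<Omega> :: "(real ^ 'd) set"
    and M :: "(real ^ 'd) measure"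
    and a :: "real \<Rightarrow> real"
    and u0 :: "real \<Rightarrow> real ^ 'd \<Rightarrow> real"
    and u :: "real \<Rightarrow> real \<Rightarrow> real ^ 'd \<Rightarrow> real"
    and f :: "real \<Rightarrow> real \<Rightarrow> real \<Rightarrow> real"
    and T :: real
  assumes "prob_space M"
    and "sets M = sets (restrict_space borel \<Omega>)"
    and "\<forall>U. 0 \<le> a U"
    and "\<forall>U. a differentiable (at U)"
    and "strictly_convex a"
    and "\<forall>x. u0 x \<in> borel_measurable M"
    and "\<forall>t\<ge>0. \<forall>x. u t x \<in> borel_measurable M"
    and "\<forall>t\<ge>0. \<forall>x. is_pdf (pointwise_statistics M u t x) (f t x)"
    and "0 < T"
    and "no_shocks_almost_surely a T M u0 u"
  shows "solves_pdf_equation_distributionally a T f \<and>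
         (regular_density T f \<longrightarrow> solves_pdf_equation_pointwise a T f)"
proof -
  obtain v where v: "random_solution M (deriv a) T v"
    and law: "\<And>t x. t \<in> {0<..<T} \<Longrightarrow> distr M borel (v t x) = distr M borel (u t x)"
    using no_shocks_random_solution[of M a u T u0] assms by blast
  interpret random_solution M "deriv a" T v by (rule v)
  have pdf: "is_pdf (distr M borel (v t x)) (f t x)" if "t \<in> {0<..<T}" for t x
    using assms(8) that by (simp add: law pointwise_statistics_def)
  note fi = F_eq_integral_density(1)[OF pdf] and fF = F_eq_integral_density(2)[OF pdf]
  show ?thesis
    unfolding solves_pdf_equation_distributionally_def
    using pdf_equation_distributional[OF \<open>0 < T\<close> fi fF] pdf_equation_pointwise[OF refl _ fi fF]
    by blast
qed

end
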